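(* Let $x=\Gamma g\in X$ with $\xi_g=g\infty\notin\mathbb P^1(\mathbb F_q(t))$, and let $B_r$ (return times) and $d_r$ (digit degrees), $r\ge1$, be indexed as described in the context. Let $\Phi:2\mathbb Z_{\ge0}\to\mathbb C$ satisfy $|\Phi(2m)|\le Cq^{\alpha m}$ for all $m\ge0$, with $C>0$ and $\alpha<2$. Set $$E_N(\Phi;x)=\left|\lambda^{\mathrm{den}}_{x,N}(\Phi\circ h_K)-\langle\Phi\rangle_{\rho^{\mathrm{ev}}}\right|,\qquad \beta=\frac{2-\alpha}{2}.$$ On the ascending half, where $N=B_r+j$ and $0\le j\le d_r-1$, $$E_{B_r+j}(\Phi;x)\ll_{q,\alpha}Cq^{-\beta B_r}.$$ On the descending half, where $N=B_r+d_r+j$ and $0\le j\le d_r-1$, $$E_{B_r+d_r+j}(\Phi;x)\ll\begin{cases}Cq^{-B_r/2-j},&\alpha<1,\\ C(B_r+d_r+j+1)q^{-B_r/2-j},&\alpha=1,\\ Cq^{-\beta B_r+(\alpha-1)d_r-j},&1<\alpha<2,\end{cases}$$ where the implicit constant depends only on $q,\alpha$ (only on $q$ in the middle line). Thus the factor at $\alpha=1$ is linear in the scale $N=B_r+d_r+j$, equivalently logarithmic in the ball volume $q^N$.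
   Context: Let $q$ be a prime power, $F=\mathbb F_q((t^{-1}))$, $\mathcal O=\mathbb F_q[[t^{-1}]]$, $\pi=t^{-1}$, $G=\mathrm{SL}_2(F)$, $\Gamma=\mathrm{SL}_2(\mathbb F_q[t])$, $K=\mathrm{SL}_2(\mathcal O)$, $X=\Gamma\backslash G$. Put $u(s)=\begin{pmatrix}1&s\\0&1\end{pmatrix}$, and let $ds$ be Haar measure on $F$ with $ds(\mathcal O)=1$. $\mathcal T$ is the Bruhat--Tits tree of $\mathrm{PGL}_2(F)$: vertices are homothety classes $[L]$ of $\mathcal O$-lattices in $F^2$, adjacent if representatives can be chosen with $\pi L\subsetneq L'\subsetneq L$, $L/L'\simeq\mathbb F_q$. Put $\bar a_n=[\mathrm{diag}(t^n,1)]$, $v_0=[\mathcal O^2]$, $v_n=\bar a_nv_0$. The quotient of $\mathcal T$ by $\mathrm{PGL}_2(\mathbb F_q[t])$ is a ray represented by $v_0-v_1-v_2-\cdots$, and $h(v)$ is the $n\ge0$ for which $v$ lies in the $\mathrm{PGL}_2(\mathbb F_q[t])$-orbit of $v_n$. The spherical height map is $h_K:X\to2\mathbb Z_{\ge0}$, $h_K(\Gamma g)=h(gv_0)$. The boundary of $\mathcal T$ is $\mathbb P^1(F)$, $\infty=[1:0]$. For $x=\Gamma g$ and $N\ge0$: $\lambda^{\mathrm{den}}_{x,N}(f)=q^{-N}\int_{t^N\mathcal O}f(xu(s))\,ds$, and $k_N(x)=h(g\bar a_Nv_0)$. Artin continued fraction: for $\xi\in F\setminus\mathbb F_q(t)$,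 $\xi_0=\xi$, $A_r=\lfloor\xi_r\rfloor$ (polynomial part: the unique polynomial with $\xi_r-A_r\in t^{-1}\mathcal O$), $\xi_{r+1}=(\xi_r-A_r)^{-1}$; $\deg A_r\ge1$ for $r\ge1$. Indexing: for irrational $\xi_g$ there are infinitely many return times, i.e. $N\ge0$ with $k_N(x)=0$, $k_{N+1}(x)=1$. After discarding a possible finite initial segment of them, $B_1<B_2<\cdots$ denote the successive return times, and, after deleting and relabeling finitely many initial continued-fraction digits of $\xi_g$, $d_r=\deg A_r$ equals the maximum of $k_N(x)$ for $B_r\le N\le B_{r+1}$, with $B_{r+1}=B_r+2d_r$. $\rho^{\mathrm{ev}}$ on $2\mathbb Z_{\ge0}$: $\rho^{\mathrm{ev}}(0)=\frac{q-1}{q}$, $\rho^{\mathrm{ev}}(2m)=(q^2-1)q^{-2m-1}$ ($m\ge1$); $\langle\Phi\rangle_{\rho^{\mathrm{ev}}}=\sum_{m\ge0}\Phi(2m)\rho^{\mathrm{ev}}(2m)$. $A\ll_pB$ means $|A|\le C'B$ with $C'$ depending only on the indicated parameters. *)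

theory Defs
  imports
    "HOL-Analysis.Analysis"
    "HOL-Computational_Algebra.Formal_Laurent_Series"
begin

text \<open>
  The finite field \<open>\<F>\<^sub>q\<close> is a type \<open>'a :: {finite, field}\<close> with \<open>q = CARD('a)\<close>.
  The field \<open>F = \<F>\<^sub>q((t\<inverse>))\<close> is the type \<open>'a fls\<close> of formal Laurent series in the
  indeterminate \<open>\<pi> = t\<inverse>\<close>; hence \<^const>\<open>fls_X\<close> is \<open>\<pi>\<close> and \<^const>\<open>fls_X_inv\<close> is \<open>t\<close>.
  The library topology on \<open>'a fls\<close> is the \<open>\<pi>\<close>-adic one.
\<close>

type_synonym 'a vec2 = "'a fls ^ 2"
type_synonym 'a mat2 = "'a fls ^ 2 ^ 2"


subsection \<open>The ring of integers, polynomials and rational functions inside \<open>F\<close>\<close>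

definition ring_O :: "'a::{finite,field} fls set" where
  "ring_O = range fps_to_fls"

definition tpow_O :: "nat \<Rightarrow> 'a::{finite,field} fls set" where
  "tpow_O N = (\<lambda>f. fls_X_inv ^ N * f) ` ring_O"

definition poly_at_t :: "'a::{finite,field} poly \<Rightarrow> 'a fls" where
  "poly_at_t p = poly (map_poly fls_const p) fls_X_inv"

definition rat_funs :: "'a::{finite,field} fls set" where
  "rat_funs = {poly_at_t p / poly_at_t r |p r. r \<noteq> 0}"


subsection \<open>Groups and the homogeneous space \<open>X = \<Gamma>\G\<close>\<close>

definition SL2_F :: "'a::{finite,field} mat2 set" where
  "SL2_F = {g. det g = 1}"

definition mat_at_t :: "'a::{finite,field} poly ^ 2 ^ 2 \<Rightarrow> 'a mat2" where
  "mat_at_t M = (\<chi> i j. poly_at_t (M $ i $ j))"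

definition SL2_poly :: "'a::{finite,field} mat2 set" where
  "SL2_poly = mat_at_t ` {M. det M = 1}"

definition GL2_poly :: "'a::{finite,field} mat2 set" where
  "GL2_poly = mat_at_t ` {M. invertible M}"

definition coset :: "'a::{finite,field} mat2 \<Rightarrow> 'a mat2 set" where
  "coset g = (\<lambda>\<gamma>. \<gamma> ** g) ` SL2_poly"

definition space_X :: "'a::{finite,field} mat2 set set" where
  "space_X = coset ` SL2_F"

definition right_translate :: "'a::{finite,field} mat2 set \<Rightarrow> 'a mat2 \<Rightarrow> 'a mat2 set" where
  "right_translate x h = (\<lambda>m. m ** h) ` x"

definition unip :: "'a::{finite,field} fls \<Rightarrow> 'a mat2" where
  "unip s = vector [vector [1, s], vector [0, 1]]"

definition diag_t :: "nat \<Rightarrow> 'a::{finite,field} mat2" where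
  "diag_t n = vector [vector [fls_X_inv ^ n, 0], vector [0, 1]]"


subsection \<open>Vertices of the tree and the height\<close>

text \<open>
  A vertex is the set of all homothets of a lattice. The action of \<open>PGL\<^sub>2\<close> on vertices is
  written through representing matrices.  Since \<open>PGL\<^sub>2(\<F>\<^sub>q[t])\<close> is the image of
  \<open>GL\<^sub>2(\<F>\<^sub>q[t])\<close>, the two groups have the same orbits of vertices.
\<close>

definition std_lattice :: "'a::{finite,field} vec2 set" where
  "std_lattice = {v. \<forall>i. v $ i \<in> ring_O}"

definition homothety_class :: "'a::{finite,field} vec2 set \<Rightarrow> 'a vec2 set set" where
  "homothety_class L = {(\<lambda>v. c *s v) ` L |c. c \<noteq> 0}"

definition act_vertex :: "'a::{finite,field} mat2 \<Rightarrow> 'a vec2 set set \<Rightarrow> 'a vec2 set set" where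
  "act_vertex g V = (\<lambda>L. (\<lambda>v. g *v v) ` L) ` V"

definition vertex :: "nat \<Rightarrow> 'a::{finite,field} vec2 set set" where
  "vertex n = act_vertex (diag_t n) (homothety_class std_lattice)"

definition height :: "'a::{finite,field} vec2 set set \<Rightarrow> nat" where
  "height V = (THE n. \<exists>\<gamma>\<in>GL2_poly. V = act_vertex \<gamma> (vertex n))"

text \<open>
  Functions on \<open>X\<close> given on representatives: the value is the common one over
  all matrices in the coset \<open>x\<close>.
\<close>

definition h_K :: "'a::{finite,field} mat2 set \<Rightarrow> nat" where
  "h_K x = (THE n. \<forall>g\<in>x. n = height (act_vertex g (vertex 0)))"

definition k_height :: "'a::{finite,field} mat2 set \<Rightarrow> nat \<Rightarrow> nat" where
  "k_height x N = (THE n. \<forall>g\<in>x. n = height (act_vertex g (act_vertex (diag_t N) (vertex 0))))"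


subsection \<open>The boundary \<open>\<P>\<^sup>1(F)\<close> and continued fractions\<close>

definition proj_pt :: "'a::{finite,field} vec2 \<Rightarrow> 'a vec2 set" where
  "proj_pt v = {c *s v |c. c \<noteq> 0}"

definition P1_rat :: "'a::{finite,field} vec2 set set" where
  "P1_rat = {proj_pt v |v. v \<noteq> 0 \<and> (\<forall>i. v $ i \<in> rat_funs)}"

definition pt_infinity :: "'a::{finite,field} vec2 set" where
  "pt_infinity = proj_pt (vector [1, 0])"

definition act_P1 :: "'a::{finite,field} mat2 \<Rightarrow> 'a vec2 set \<Rightarrow> 'a vec2 set" where
  "act_P1 g P = (\<lambda>v. g *v v) ` P"

text \<open>The identification of \<open>\<P>\<^sup>1(F) - {\<infinity>}\<close> with \<open>F\<close>; unspecified at \<open>\<infinity>\<close>.\<close>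

definition affine_coord :: "'a::{finite,field} vec2 set \<Rightarrow> 'a fls" where
  "affine_coord P = (THE \<xi>. P = proj_pt (vector [\<xi>, 1]))"

definition poly_part :: "'a::{finite,field} fls \<Rightarrow> 'a poly" where
  "poly_part \<xi> = (THE A. \<xi> - poly_at_t A \<in> (\<lambda>f. fls_X * f) ` ring_O)"

fun cf_tail :: "'a::{finite,field} fls \<Rightarrow> nat \<Rightarrow> 'a fls" where
  "cf_tail \<xi> 0 = \<xi>"
| "cf_tail \<xi> (Suc r) = inverse (cf_tail \<xi> r - poly_at_t (poly_part (cf_tail \<xi> r)))"

definition cf_digit :: "'a::{finite,field} fls \<Rightarrow> nat \<Rightarrow> 'a poly" where
  "cf_digit \<xi> r = poly_part (cf_tail \<xi> r)"


subsection \<open>Return times and their indexing\<close>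

definition return_times :: "'a::{finite,field} mat2 set \<Rightarrow> nat set" where
  "return_times x = {N. k_height x N = 0 \<and> k_height x (N + 1) = 1}"

text \<open>
  \<open>B r\<close> and \<open>d r\<close> matter only for \<open>r \<ge> 1\<close>.  The first two conditions say that
  \<open>B 1 < B 2 < \<dots>\<close> lists all return times from some point on; \<open>b\<close> is the number of deleted
  continued-fraction digits among those of index at least 1.
\<close>

definition admissible_indexing ::
    "'a::{finite,field} mat2 \<Rightarrow> (nat \<Rightarrow> nat) \<Rightarrow> (nat \<Rightarrow> nat) \<Rightarrow> bool" where
  "admissible_indexing g B d \<longleftrightarrow>
     strict_mono_on {1..} B \<and>
     (\<exists>N0. B ` {1..} = {N \<in> return_times (coset g). N0 \<le> N}) \<and>
     (\<exists>b. \<forall>r\<ge>1. d r = degree (cf_digit (affine_coord (act_P1 g pt_infinity)) (b + r))) \<and>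
     (\<forall>r\<ge>1. d r = Max (k_height (coset g) ` {B r..B (r + 1)}) \<and> B (r + 1) = B r + 2 * d r)"


subsection \<open>Haar measure, dense horospherical averages and the limit distribution\<close>

text \<open>On the second countable group \<open>F\<close>, a translation invariant Borel measure giving the compact
  open subgroup \<open>\<O>\<close> mass 1 is automatically Radon, so this is the normalised Haar measure.\<close>

definition normalized_haar :: "'a::{finite,field} fls measure \<Rightarrow> bool" where
  "normalized_haar \<mu> \<longleftrightarrow>
     sets \<mu> = sets borel \<and>
     (\<forall>a. \<forall>S\<in>sets borel. emeasure \<mu> ((\<lambda>s. a + s) ` S) = emeasure \<mu> S) \<and>
     emeasure \<mu> ring_O = 1"

definition lambda_den ::
    "'a::{finite,field} fls measure \<Rightarrow> 'a mat2 set \<Rightarrow> nat \<Rightarrow> ('a mat2 set \<Rightarrow> complex) \<Rightarrow> complex" where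
  "lambda_den \<mu> x N f =
     (LINT s:tpow_O N|\<mu>. f (right_translate x (unip s))) / of_nat (CARD('a) ^ N)"

definition rho_ev :: "nat \<Rightarrow> nat \<Rightarrow> real" where
  "rho_ev q n = (if n = 0 then (real q - 1) / real q else ((real q)\<^sup>2 - 1) / real q ^ (n + 1))"

definition mean_rho_ev :: "nat \<Rightarrow> (nat \<Rightarrow> complex) \<Rightarrow> complex" where
  "mean_rho_ev q \<Phi> = (\<Sum>m. \<Phi> (2 * m) * of_real (rho_ev q (2 * m)))"

definition err ::
    "'a::{finite,field} fls measure \<Rightarrow> (nat \<Rightarrow> complex) \<Rightarrow> 'a mat2 set \<Rightarrow> nat \<Rightarrow> real" where
  "err \<mu> \<Phi> x N = cmod (lambda_den \<mu> x N (\<Phi> \<circ> h_K) - mean_rho_ev CARD('a) \<Phi>)"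

end

theory Submission
  imports Defs
begin

text \<open>The vertices \<open>g u(s) v\<^sub>0\<close> with \<open>s \<in> t\<^sup>N \<O>\<close> are the \<open>q\<^sup>N\<close> end points of the paths of length \<open>N\<close> which start
at \<open>g v\<^sub>N\<close> and never step back or towards \<open>g\<infinity>\<close>, so the horospherical average is the expectation of
\<open>\<Phi>\<close> at the final height of a nonbacktracking random walk. A vertex of height \<open>n \<ge> 1\<close> has exactly one
neighbour of height \<open>n + 1\<close> and \<open>q\<close> neighbours of height \<open>n - 1\<close>, while all neighbours of a vertex of height
\<open>0\<close> have height \<open>1\<close> (lemma \<open>neighbour_heights\<close>). Hence the law of the final height depends only on
\<open>k\<^sub>N(x)\<close>, on \<open>k\<^sub>N\<^sub>+\<^sub>1(x)\<close> and on \<open>N\<close>: a walk which has just gone down keeps going down until it reaches \<open>0\<close>, and one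
which has just gone up goes up again with probability \<open>1/q\<close>.

These probabilities have a closed form (lemma \<open>emeasure_high\<close>). With \<open>n = k\<^sub>N(x)\<close> and
\<open>1 \<le> k \<le> (N - n)/2\<close>, the final height is at least \<open>2k\<close> with probability exactly \<open>q\<^bsup>1-2k\<^esup>\<close>, which is the
mass that \<open>\<rho>\<^sup>e\<^sup>v\<close> gives to the heights from \<open>2k\<close> on. After summation by parts in the height, only large
\<open>k\<close> contribute to the error (lemma \<open>mean_error\<close>).

Between two return times, \<open>N \<mapsto> k\<^sub>N(x)\<close> moves by \<open>\<plusminus>1\<close> and attains its maximum \<open>d\<close> although it has only
\<open>2d\<close> steps to leave \<open>0\<close> and come back, so it climbs straight to \<open>d\<close> and falls straight back
(lemma \<open>excursion_shape\<close>). On the ascending half, \<open>g v\<^sub>N\<close> is lower than \<open>g v\<^sub>N\<^sub>+\<^sub>1\<close>, the walk starts by descending,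
the tails agree with those of \<open>\<rho>\<^sup>e\<^sup>v\<close> up to \<open>k = B/2\<close> and then vanish, so that the error is a tail of the mean, summed by
parts (lemma \<open>err_from_above\<close>). On the descending half the walk may first climb. The tails are correct up
to \<open>H = B/2 + j\<close>, and from there to \<open>K = B/2 + d\<close> they are \<open>q\<^bsup>-H-k\<^esup>\<close> (lemma \<open>err_from_below\<close>). Against increments
of \<open>\<Phi>\<close> of size \<open>C q\<^bsup>\<alpha>k\<^esup>\<close> this yields \<open>C q\<^bsup>-H\<^esup>\<close> times the sum of \<open>q\<^bsup>(\<alpha>-1)k\<^esup>\<close> over \<open>H < k \<le> K\<close>,
whose three regimes \<open>\<alpha> < 1\<close>, \<open>\<alpha> = 1\<close> and \<open>\<alpha> > 1\<close> are those of the theorem.\<close>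

(* The dollar sign is reserved for the components of vectors. *)
no_notation fps_nth (infixl "$" 75)

section \<open>Integers and polynomials in \<open>F\<close>\<close>

lemma ring_O_iff: "f \<in> ring_O \<longleftrightarrow> 0 \<le> fls_subdegree f"
proof
  show "f \<in> ring_O \<Longrightarrow> 0 \<le> fls_subdegree f"
    by (auto simp: ring_O_def fls_subdegree_fls_to_fps_gt0)
  show "0 \<le> fls_subdegree f \<Longrightarrow> f \<in> ring_O"
    by (metis fls_regpart_to_fls_trivial ring_O_def rangeI)
qed

lemma ring_O_0 [simp]: "0 \<in> ring_O" and ring_O_1 [simp]: "1 \<in> ring_O"
  and ring_O_const [simp]: "fls_const c \<in> ring_O" and ring_O_X [simp]: "fls_X \<in> ring_O"
  by (simp_all add: ring_O_iff)

lemma ring_O_add: "f \<in> ring_O \<Longrightarrow> h \<in> ring_O \<Longrightarrow> f + h \<in> ring_O"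
  and ring_O_diff: "f \<in> ring_O \<Longrightarrow> h \<in> ring_O \<Longrightarrow> f - h \<in> ring_O"
  and ring_O_mult: "f \<in> ring_O \<Longrightarrow> h \<in> ring_O \<Longrightarrow> f * h \<in> ring_O"
  unfolding ring_O_def
  by (clarify, metis fps_to_fls_plus rangeI, clarify, metis fps_to_fls_minus rangeI,
      clarify, metis fls_times_fps_to_fls rangeI)

lemma ring_O_uminus [simp]: "- f \<in> ring_O \<longleftrightarrow> f \<in> ring_O"
  by (simp add: ring_O_iff)

lemmas ring_O_closed = ring_O_add ring_O_diff ring_O_mult

lemma residue_mult: "f \<in> ring_O \<Longrightarrow> h \<in> ring_O \<Longrightarrow> fls_nth (f * h) 0 = fls_nth f 0 * fls_nth h 0"
  unfolding ring_O_def by (auto simp flip: fls_times_fps_to_fls)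

lemma X_times_X_inv [simp]: "fls_X * fls_X_inv = (1 :: 'a::field fls)"
  "fls_X_inv * fls_X = (1 :: 'a::field fls)"
  by (metis fls_X_nonzero fls_inverse_X right_inverse, metis fls_X_nonzero fls_inverse_X left_inverse)

lemma ring_O_div_X: "f \<in> ring_O \<Longrightarrow> fls_nth f 0 = 0 \<Longrightarrow> fls_X_inv * f \<in> ring_O"
proof (cases "f = 0")
  case False
  assume f: "f \<in> ring_O" "fls_nth f 0 = 0"
  have "fls_subdegree f \<noteq> 0"
    using False f(2) by (metis nth_fls_subdegree_nonzero)
  then show ?thesis
    using f(1) False by (simp add: ring_O_iff)
qed simp

lemma ring_O_inverse: "f \<in> ring_O \<Longrightarrow> fls_nth f 0 \<noteq> 0 \<Longrightarrow> inverse f \<in> ring_O"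
  using fls_subdegree_leI[of f 0] by (auto simp: ring_O_iff)

lemma unit_residue: "f \<in> ring_O \<Longrightarrow> inverse f \<in> ring_O \<Longrightarrow> f \<noteq> 0 \<Longrightarrow> fls_nth f 0 \<noteq> 0"
  by (metis fls_one_nth mult_zero_left residue_mult right_inverse zero_neq_one)

lemma fls_const_add: "fls_const (a + b) = fls_const a + fls_const b"
  by (rule fls_eqI) simp

lemma poly_at_t_0 [simp]: "poly_at_t 0 = 0" and poly_at_t_1 [simp]: "poly_at_t 1 = 1"
  by (simp_all add: poly_at_t_def)

lemma poly_at_t_pCons [simp]: "poly_at_t (pCons a p) = fls_const a + fls_X_inv * poly_at_t p"
  by (simp add: poly_at_t_def map_poly_pCons)

lemma poly_at_t_add [simp]: "poly_at_t (p + r) = poly_at_t p + poly_at_t r"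
proof (induction p arbitrary: r)
  case (pCons a p)
  show ?case
    by (cases r) (simp add: pCons.IH fls_const_add distrib_left)
qed simp

lemma poly_at_t_smult [simp]: "poly_at_t (smult c p) = fls_const c * poly_at_t p"
  by (induction p) (simp_all add: fls_const_mult_const algebra_simps)

lemma poly_at_t_mult [simp]: "poly_at_t (p * r) = poly_at_t p * poly_at_t r"
  by (induction p) (simp_all add: algebra_simps)

lemma poly_at_t_uminus [simp]: "poly_at_t (- p) = - poly_at_t p"
  by (metis add.right_inverse add_eq_0_iff poly_at_t_0 poly_at_t_add)

lemma poly_at_t_diff [simp]: "poly_at_t (p - r) = poly_at_t p - poly_at_t r"
  by (metis diff_conv_add_uminus poly_at_t_add poly_at_t_uminus)

lemma poly_at_t_monom: "poly_at_t (monom c n) = fls_const c * fls_X_inv ^ n"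
  by (induction n) (simp_all add: monom_0 monom_Suc algebra_simps)

text \<open>Polynomials in \<open>t = \<pi>\<inverse>\<close> have no terms of positive order in \<open>\<pi>\<close>. Stated through the order of vanishing, this is
  what makes reduction theory work: a polynomial which is small must be zero.\<close>

lemma poly_at_t_nth: "0 < k \<Longrightarrow> fls_nth (poly_at_t p) k = 0"
proof (induction p arbitrary: k)
  case (pCons a p)
  then show ?case
    by (auto simp: fls_X_inv_times_conv_shift)
qed simp

lemma poly_at_t_subdegree: "fls_subdegree (poly_at_t p) \<le> 0"
  by (metis fls_zero_subdegree linorder_le_less_linear nth_fls_subdegree_nonzero order_refl poly_at_t_nth)

section \<open>Two by two matrices and the groups acting on the tree\<close>

definition mat2 :: "'b \<Rightarrow> 'b \<Rightarrow> 'b \<Rightarrow> 'b \<Rightarrow> 'b::zero ^ 2 ^ 2" where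
  "mat2 a b c d = vector [vector [a, b], vector [c, d]]"

lemma mat2_nth [simp]:
  "mat2 a b c d $ 1 $ 1 = a" "mat2 a b c d $ 1 $ 2 = b"
  "mat2 a b c d $ 2 $ 1 = c" "mat2 a b c d $ 2 $ 2 = d"
  by (simp_all add: mat2_def)

lemma mat2_eta: "mat2 (m $ 1 $ 1) (m $ 1 $ 2) (m $ 2 $ 1) (m $ 2 $ 2) = m"
  by (simp add: vec_eq_iff forall_2)

lemma mat2_eq_iff [simp]: "mat2 a b c d = mat2 a' b' c' d' \<longleftrightarrow> a = a' \<and> b = b' \<and> c = c' \<and> d = d'"
  by (metis mat2_nth)

lemma mat2_cases [cases type]: obtains a b c d where "m = mat2 a b c d"
  by (metis mat2_eta)

lemma mat2_mult [simp]: "mat2 a b c d ** mat2 a' b' c' d' =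
    mat2 (a * a' + b * c') (a * b' + b * d') (c * a' + d * c') (c * b' + d * (d' :: 'b::semiring_1))"
  by (simp add: vec_eq_iff forall_2 matrix_matrix_mult_def sum_2)

lemma det_mat2 [simp]: "det (mat2 a b c d) = a * d - b * (c :: 'b::comm_ring_1)"
  by (simp add: det_2)

lemma mat_1_mat2: "mat 1 = mat2 1 0 0 (1 :: 'b::zero_neq_one)"
  by (simp add: vec_eq_iff forall_2 mat_def)

lemma unip_mat2: "unip s = mat2 1 s 0 1" and diag_t_mat2: "diag_t n = mat2 (fls_X_inv ^ n) 0 0 1"
  by (simp_all add: unip_def diag_t_def mat2_def)

lemma det_unip [simp]: "det (unip s) = 1" and det_diag_t [simp]: "det (diag_t n) = fls_X_inv ^ n"
  by (simp_all add: unip_mat2 diag_t_mat2)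

lemma unip_mult: "unip s ** unip s' = unip (s + s')"
  by (simp add: unip_mat2 add.commute)

lemma mat_inverse_of_det:
  assumes "det (m :: 'b::field ^ 2 ^ 2) \<noteq> 0"
  obtains m' where "m ** m' = mat 1" "m' ** m = mat 1"
  using assms by (metis invertible_def invertible_det_nz)

lemma mat_at_t_mat2: "mat_at_t (mat2 a b c d) = mat2 (poly_at_t a) (poly_at_t b) (poly_at_t c) (poly_at_t d)"
  by (simp add: mat_at_t_def vec_eq_iff forall_2)

lemma mat_at_t_mult: "mat_at_t (M ** N) = mat_at_t M ** mat_at_t N"
  by (cases M; cases N) (simp add: mat_at_t_mat2)

lemma mat_at_t_1: "mat_at_t (mat 1) = mat 1"
  by (simp add: mat_1_mat2 mat_at_t_mat2)

lemma GL2_poly_mult: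
  assumes "m \<in> GL2_poly" "n \<in> GL2_poly" shows "m ** n \<in> GL2_poly"
proof -
  obtain M N where MN: "m = mat_at_t M" "invertible M" "n = mat_at_t N" "invertible N"
    using assms by (auto simp: GL2_poly_def)
  then obtain M' N' where "M ** M' = mat 1" "M' ** M = mat 1" "N ** N' = mat 1" "N' ** N = mat 1"
    by (auto simp: invertible_def)
  then have "(M ** N) ** (N' ** M') = mat 1" "(N' ** M') ** (M ** N) = mat 1"
    by (metis matrix_mul_assoc matrix_mul_rid)+
  then have "invertible (M ** N)"
    by (auto simp: invertible_def)
  then show ?thesis
    using MN by (auto simp: GL2_poly_def simp flip: mat_at_t_mult)
qed

lemma GL2_poly_inverse:
  assumes "m \<in> GL2_poly"
  obtains m' where "m' \<in> GL2_poly" "m ** m' = mat 1" "m' ** m = mat 1"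
proof -
  obtain M where M: "m = mat_at_t M" "invertible M"
    using assms by (auto simp: GL2_poly_def)
  then obtain M' where M': "M ** M' = mat 1" "M' ** M = mat 1"
    by (auto simp: invertible_def)
  then have "invertible M'"
    by (auto simp: invertible_def)
  then show ?thesis
    using that[of "mat_at_t M'"] M M'
    by (auto simp: GL2_poly_def mat_at_t_1 simp flip: mat_at_t_mult)
qed

text \<open>The determinant and its inverse are both polynomials in \<open>t\<close>, so both have degree zero.\<close>

lemma GL2_poly_det:
  assumes "m \<in> GL2_poly" shows "det m \<noteq> 0" "fls_subdegree (det m) = 0"
proof -
  obtain m' where m': "m' \<in> GL2_poly" "m ** m' = mat 1"
    using GL2_poly_inverse[OF assms] .
  have le: "fls_subdegree (det n) \<le> 0" if "n \<in> GL2_poly" for n :: "'a mat2"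
  proof -
    obtain M where "n = mat_at_t M" using \<open>n \<in> GL2_poly\<close> by (auto simp: GL2_poly_def)
    then have "det n = poly_at_t (det M)"
      by (cases M) (simp add: mat_at_t_mat2)
    then show ?thesis by (simp add: poly_at_t_subdegree)
  qed
  have 1: "det m * det m' = 1"
    using m'(2) by (metis det_I det_mul)
  then show "det m \<noteq> 0" by auto
  then have "fls_subdegree (det m) + fls_subdegree (det m') = 0"
    using 1 by (metis fls_one_subdegree fls_subdegree_mult mult_zero_right zero_neq_one)
  then show "fls_subdegree (det m) = 0"
    using le[OF assms] le[OF m'(1)] by simp
qed

lemma GL2_poly_entries:
  assumes "mat2 a b c d \<in> GL2_poly"
  shows "fls_subdegree a \<le> 0" "fls_subdegree b \<le> 0" "fls_subdegree c \<le> 0" "fls_subdegree d \<le> 0"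
proof -
  obtain M where M: "mat2 a b c d = mat_at_t M" using assms by (auto simp: GL2_poly_def)
  show "fls_subdegree a \<le> 0" "fls_subdegree b \<le> 0" "fls_subdegree c \<le> 0" "fls_subdegree d \<le> 0"
    using M by (cases M; simp add: mat_at_t_mat2 poly_at_t_subdegree)+
qed

lemma SL2_poly_subset_GL2_poly: "SL2_poly \<subseteq> GL2_poly"
proof
  fix m :: "'a mat2" assume "m \<in> SL2_poly"
  then obtain a b c d where m: "m = mat_at_t (mat2 a b c d)" "a * d - b * c = 1"
    unfolding SL2_poly_def by (smt (verit) det_mat2 imageE mat2_cases mem_Collect_eq)
  have "invertible (mat2 a b c d)"
    unfolding invertible_def mat_1_mat2 using m(2)
    by (intro exI[of _ "mat2 d (- b) (- c) a"]) (simp add: algebra_simps)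
  then show "m \<in> GL2_poly"
    using m(1) by (simp add: GL2_poly_def)
qed

lemma GL2_poly_1: "mat 1 \<in> GL2_poly"
  unfolding GL2_poly_def
  by (rule image_eqI[where x = "mat 1"]) (auto simp: mat_at_t_1 invertible_def)

lemma unip_GL2_poly: "unip (poly_at_t p) \<in> GL2_poly"
proof -
  have "unip (poly_at_t p) = mat_at_t (mat2 1 p 0 1)"
    by (simp add: unip_mat2 mat_at_t_mat2)
  then have "unip (poly_at_t p) \<in> SL2_poly"
    unfolding SL2_poly_def by simp
  then show ?thesis using SL2_poly_subset_GL2_poly by blast
qed

definition weyl :: "'b::zero_neq_one ^ 2 ^ 2" where
  "weyl = mat2 0 1 1 0"

lemma weyl_GL2_poly: "weyl \<in> GL2_poly"
proof -
  have "invertible (weyl :: 'a poly ^ 2 ^ 2)"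
    unfolding invertible_def weyl_def mat_1_mat2 by (intro exI[of _ weyl]) (simp add: weyl_def)
  moreover have "weyl = mat_at_t (weyl :: 'a poly ^ 2 ^ 2)"
    by (simp add: weyl_def mat_at_t_mat2)
  ultimately show ?thesis by (simp add: GL2_poly_def)
qed

text \<open>Asking for a nonzero residue of the determinant is the same as asking that it be a unit of \<open>\<O>\<close>.\<close>

definition GL2_O :: "'a::{finite,field} mat2 set" where
  "GL2_O = {mat2 a b c d |a b c d. a \<in> ring_O \<and> b \<in> ring_O \<and> c \<in> ring_O \<and> d \<in> ring_O \<and>
     fls_nth (a * d - b * c) 0 \<noteq> 0}"

lemma mat2_GL2_O: "mat2 a b c d \<in> GL2_O \<longleftrightarrow>
    a \<in> ring_O \<and> b \<in> ring_O \<and> c \<in> ring_O \<and> d \<in> ring_O \<and> fls_nth (a * d - b * c) 0 \<noteq> 0"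
  by (auto simp: GL2_O_def)

lemma GL2_O_det: "m \<in> GL2_O \<Longrightarrow> fls_subdegree (det m) = 0" "m \<in> GL2_O \<Longrightarrow> det m \<noteq> 0"
proof -
  assume "m \<in> GL2_O"
  then obtain a b c d where m: "m = mat2 a b c d" "mat2 a b c d \<in> GL2_O"
    by (cases m) auto
  then have "det m \<in> ring_O" "fls_nth (det m) 0 \<noteq> 0"
    by (auto simp: mat2_GL2_O intro!: ring_O_closed)
  then show "fls_subdegree (det m) = 0" "det m \<noteq> 0"
    by (auto simp: ring_O_iff intro: antisym fls_subdegree_leI)
qed

lemma GL2_O_mult:
  assumes "m \<in> GL2_O" "n \<in> GL2_O" shows "m ** n \<in> GL2_O"
proof -
  obtain a b c d a' b' c' d' where mn: "m = mat2 a b c d" "n = mat2 a' b' c' d'"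
    by (metis mat2_cases)
  have *: "(a*a' + b*c') * (c*b' + d*d') - (a*b' + b*d') * (c*a' + d*c') = (a*d-b*c) * (a'*d'-b'*c')"
    by (simp add: algebra_simps)
  have "fls_nth ((a*d-b*c) * (a'*d'-b'*c')) 0 \<noteq> 0"
    using assms unfolding mn mat2_GL2_O by (subst residue_mult) (auto intro: ring_O_closed)
  then show ?thesis
    using assms unfolding mn mat2_mult mat2_GL2_O * by (auto intro!: ring_O_closed)
qed

lemma GL2_O_inverse:
  assumes "m \<in> GL2_O"
  obtains m' where "m' \<in> GL2_O" "m ** m' = mat 1" "m' ** m = mat 1"
proof -
  obtain a b c d where m: "m = mat2 a b c d" by (cases m)
  define e where "e = a * d - b * c"
  have e: "e \<in> ring_O" "fls_nth e 0 \<noteq> 0" and O: "a \<in> ring_O" "b \<in> ring_O" "c \<in> ring_O" "d \<in> ring_O"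
    using assms unfolding m mat2_GL2_O e_def by (auto intro: ring_O_closed)
  have e': "inverse e \<in> ring_O" "e \<noteq> 0"
    using e by (auto intro: ring_O_inverse)
  define m' where "m' = mat2 (inverse e * d) (- (inverse e * b)) (- (inverse e * c)) (inverse e * a)"
  have "fls_nth (inverse e) 0 \<noteq> 0"
    using e e' by (intro unit_residue) auto
  moreover have "(inverse e * d) * (inverse e * a) - (- (inverse e * b)) * (- (inverse e * c)) = inverse e"
  proof -
    have "(inverse e * d) * (inverse e * a) - (- (inverse e * b)) * (- (inverse e * c)) = inverse e * inverse e * e"
      by (simp add: e_def algebra_simps)
    then show ?thesis using e'(2) by simp
  qed
  ultimately have "m' \<in> GL2_O"
    unfolding m'_def mat2_GL2_O using O e' by (auto intro: ring_O_closed)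
  moreover have "m ** m' = mat 1" "m' ** m = mat 1"
    using e'(2) unfolding m m'_def mat_1_mat2 by (simp_all add: field_simps) (simp_all add: e_def algebra_simps)
  ultimately show ?thesis using that by blast
qed

lemma unip_GL2_O: "s \<in> ring_O \<Longrightarrow> unip s \<in> GL2_O"
  by (simp add: unip_mat2 mat2_GL2_O)

lemma weyl_GL2_O: "weyl \<in> GL2_O"
  by (simp add: weyl_def mat2_GL2_O)

section \<open>Vertices and their stabilizers\<close>

lemma act_vertex_mult: "act_vertex (A ** B) V = act_vertex A (act_vertex B V)"
  by (simp add: act_vertex_def image_image matrix_vector_mul_assoc)

lemma act_vertex_1 [simp]: "act_vertex (mat 1) V = V"
  by (simp add: act_vertex_def)

lemma act_homothety_class: "act_vertex m (homothety_class L) = homothety_class ((*v) m ` L)"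
proof -
  have "(\<lambda>L. (*v) m ` L) ` {(\<lambda>v. c *s v) ` L |c. c \<noteq> 0} = {(\<lambda>v. c *s v) ` (*v) m ` L |c. c \<noteq> 0}"
    unfolding setcompr_eq_image image_image vector_scalar_commute ..
  then show ?thesis
    by (simp add: act_vertex_def homothety_class_def)
qed

lemma vertex_0: "vertex 0 = homothety_class std_lattice"
proof -
  have "(diag_t 0 :: 'a mat2) = mat 1"
    by (simp add: diag_t_mat2 mat_1_mat2)
  then show ?thesis by (simp add: vertex_def)
qed

lemma vertex_conv: "vertex n = act_vertex (diag_t n) (vertex 0)"
  by (simp add: vertex_def[of n] vertex_0)

definition scalar :: "'b \<Rightarrow> 'b::zero ^ 2 ^ 2" where
  "scalar c = mat2 c 0 0 c"

lemma scalar_mult_vec: "scalar c *v v = c *s (v :: 'a::{finite,field} vec2)"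
  by (simp add: scalar_def vec_eq_iff forall_2 matrix_vector_mult_def sum_2)

lemma scalar_commute: "scalar c ** m = m ** scalar (c :: 'b::comm_semiring_1)"
  by (cases m) (simp add: scalar_def mult.commute)

lemma scalar_commute_right: "A ** scalar c ** B = A ** B ** scalar (c :: 'b::comm_semiring_1)"
  by (metis matrix_mul_assoc scalar_commute)

lemma scalar_mult: "scalar c ** scalar d = scalar (c * d :: 'b::comm_semiring_1)"
  by (simp add: scalar_def)

lemma scalar_1: "scalar 1 = mat (1 :: 'b::zero_neq_one)"
  by (simp only: scalar_def mat_1_mat2)

lemma det_scalar [simp]: "det (scalar c) = c * c"
  by (simp add: scalar_def)

lemma act_scalar:
  assumes "c \<noteq> 0" shows "act_vertex (m ** scalar c) (vertex 0) = act_vertex m (vertex 0)"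
proof -
  have "homothety_class ((*s) c ` L) = homothety_class L" for L :: "'a vec2 set"
  proof (intro subset_antisym subsetI)
    fix M assume "M \<in> homothety_class L"
    then obtain d where d: "d \<noteq> 0" "M = (*s) d ` L"
      by (auto simp: homothety_class_def)
    then have "M = (*s) (d / c) ` (*s) c ` L"
      using assms by (simp add: image_image)
    then show "M \<in> homothety_class ((*s) c ` L)"
      using assms d(1) unfolding homothety_class_def by (auto intro!: exI[of _ "d / c"])
  next
    fix M assume "M \<in> homothety_class ((*s) c ` L)"
    then obtain d where "d \<noteq> 0" "M = (*s) d ` (*s) c ` L"
      by (auto simp: homothety_class_def)
    then have "d * c \<noteq> 0" "M = (*s) (d * c) ` L"
      using assms by (simp_all add: image_image)
    then show "M \<in> homothety_class L"
      unfolding homothety_class_def by blast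
  qed
  then show ?thesis
    unfolding act_vertex_mult vertex_0 by (simp add: act_homothety_class scalar_mult_vec)
qed

lemma GL2_O_std_lattice:
  assumes "m \<in> GL2_O" "v \<in> std_lattice" shows "m *v v \<in> std_lattice"
proof -
  obtain a b c d where m: "m = mat2 a b c d" by (cases m)
  show ?thesis
    using assms unfolding m mat2_GL2_O
    by (auto simp: std_lattice_def forall_2 matrix_vector_mult_def sum_2 intro!: ring_O_closed)
qed

lemma act_GL2_O:
  assumes "k \<in> GL2_O" shows "act_vertex (m ** k) (vertex 0) = act_vertex m (vertex 0)"
proof -
  obtain k' where k': "k' \<in> GL2_O" "k ** k' = mat 1"
    using GL2_O_inverse[OF assms] .
  have "(*v) k ` std_lattice = std_lattice"
  proof (intro subset_antisym subsetI)
    fix v :: "'a vec2" assume v: "v \<in> std_lattice"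
    have "v = k *v (k' *v v)"
      by (simp add: matrix_vector_mul_assoc k')
    then show "v \<in> (*v) k ` std_lattice"
      using GL2_O_std_lattice[OF k'(1) v] by blast
  qed (use GL2_O_std_lattice[OF assms] in auto)
  then show ?thesis
    unfolding act_vertex_mult vertex_0 by (simp add: act_homothety_class)
qed

text \<open>A matrix fixing the class of \<open>\<O>\<^sup>2\<close> is, after rescaling, a bijection of \<open>\<O>\<^sup>2\<close>: the images of
  the basis vectors give integral entries, and the preimages of the basis vectors give an
  integral inverse, so the determinant is a unit.\<close>

lemma stabilizer_vertex_0:
  assumes "act_vertex m (vertex 0) = vertex 0"
  obtains k c where "k \<in> GL2_O" "c \<noteq> 0" "m = k ** scalar c"
proof -
  have "(*v) m ` std_lattice \<in> act_vertex m (vertex 0)"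
  proof -
    have "std_lattice \<in> vertex 0"
      unfolding vertex_0 homothety_class_def by (auto intro!: exI[of _ 1])
    then show ?thesis unfolding act_vertex_def by (rule imageI)
  qed
  then have "(*v) m ` std_lattice \<in> homothety_class std_lattice"
    unfolding assms by (simp only: vertex_0)
  then obtain c where c: "c \<noteq> 0" "(*v) m ` std_lattice = (*s) c ` std_lattice"
    unfolding homothety_class_def by blast
  define k where "k = scalar (inverse c) ** m"
  have k: "(*v) k ` std_lattice = std_lattice"
  proof -
    have "(*v) k ` std_lattice = (*s) (inverse c) ` (*v) m ` std_lattice"
      by (simp only: k_def image_image scalar_mult_vec[symmetric] matrix_vector_mul_assoc)
    also have "\<dots> = (*s) (inverse c) ` (*s) c ` std_lattice"
      by (simp only: c(2))
    also have "\<dots> = std_lattice"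
      using c(1) by (simp add: image_image)
    finally show ?thesis .
  qed
  have e: "vector [1, 0] \<in> std_lattice" "vector [0, 1] \<in> std_lattice"
    by (simp_all add: std_lattice_def forall_2)
  obtain p q r s where kk: "k = mat2 p q r s" by (cases k)
  have "k *v vector [1, 0] \<in> std_lattice" "k *v vector [0, 1] \<in> std_lattice"
    using imageI[OF e(1), of "(*v) k"] imageI[OF e(2), of "(*v) k"] unfolding k by simp_all
  then have O: "p \<in> ring_O" "q \<in> ring_O" "r \<in> ring_O" "s \<in> ring_O"
    by (auto simp: kk std_lattice_def forall_2 matrix_vector_mult_def sum_2)
  have "vector [1, 0] \<in> (*v) k ` std_lattice" "vector [0, 1] \<in> (*v) k ` std_lattice"
    using e by (simp_all only: k)
  then obtain u v where uv: "u \<in> std_lattice" "v \<in> std_lattice" "vector [1, 0] = k *v u" "vector [0, 1] = k *v v"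
    by (elim imageE)
  have "(p * s - q * r) * (u $ 1 * v $ 2 - v $ 1 * u $ 2) = 1"
  proof -
    have "p * u $ 1 + q * u $ 2 = 1" "r * u $ 1 + s * u $ 2 = 0"
      "p * v $ 1 + q * v $ 2 = 0" "r * v $ 1 + s * v $ 2 = 1"
      using uv(3,4) by (auto simp: kk vec_eq_iff forall_2 matrix_vector_mult_def sum_2)
    moreover have "(p * s - q * r) * (u $ 1 * v $ 2 - v $ 1 * u $ 2) =
        (p * u $ 1 + q * u $ 2) * (r * v $ 1 + s * v $ 2) - (p * v $ 1 + q * v $ 2) * (r * u $ 1 + s * u $ 2)"
      by (simp add: algebra_simps)
    ultimately show ?thesis by simp
  qed
  then have "fls_nth (p * s - q * r) 0 * fls_nth (u $ 1 * v $ 2 - v $ 1 * u $ 2) 0 = 1"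
    using O uv(1,2) by (subst residue_mult[symmetric]) (auto simp: std_lattice_def intro!: ring_O_closed)
  then have "k \<in> GL2_O"
    using O unfolding kk mat2_GL2_O by auto
  moreover have "m = k ** scalar c"
  proof -
    have "k ** scalar c = (scalar (inverse c) ** scalar c) ** m"
      unfolding k_def by (metis matrix_mul_assoc scalar_commute)
    then show ?thesis
      using c(1) by (simp add: scalar_mult scalar_1)
  qed
  ultimately show ?thesis using that c(1) by blast
qed

section \<open>The height of a vertex\<close>

text \<open>The relational form of the height separates its uniqueness, which comes from degrees, from its existence,
  which comes from walking through the tree.\<close>

definition has_height :: "'a::{finite,field} mat2 \<Rightarrow> nat \<Rightarrow> bool" where
  "has_height m n \<longleftrightarrow> (\<exists>\<gamma>\<in>GL2_poly. act_vertex m (vertex 0) = act_vertex \<gamma> (vertex n))"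

lemma has_height_left:
  assumes "\<gamma> \<in> GL2_poly" shows "has_height (\<gamma> ** m) n \<longleftrightarrow> has_height m n"
proof -
  have *: "has_height (\<gamma> ** m) n" if "\<gamma> \<in> GL2_poly" "has_height m n" for \<gamma> m :: "'a mat2"
    using that unfolding has_height_def by (metis GL2_poly_mult act_vertex_mult)
  obtain \<gamma>' where "\<gamma>' \<in> GL2_poly" "\<gamma>' ** \<gamma> = mat 1"
    using GL2_poly_inverse[OF assms] .
  then show ?thesis
    using *[OF assms, of m] *[of \<gamma>' "\<gamma> ** m"] by (auto simp: matrix_mul_assoc)
qed

lemma has_height_cong:
  "act_vertex m (vertex 0) = act_vertex m' (vertex 0) \<Longrightarrow> has_height m n \<longleftrightarrow> has_height m' n"
  by (simp add: has_height_def)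

lemma has_height_diag_t: "has_height (diag_t n) n"
  unfolding has_height_def vertex_conv[of n]
  by (rule bexI[OF _ GL2_poly_1]) simp

lemma same_vertex:
  assumes "det m \<noteq> 0" "act_vertex m (vertex 0) = act_vertex m' (vertex 0)"
  obtains k c where "k \<in> GL2_O" "c \<noteq> 0" "m' = m ** k ** scalar c"
proof -
  obtain m1 where m1: "m ** m1 = mat 1" "m1 ** m = mat 1"
    using mat_inverse_of_det[OF assms(1)] .
  have "act_vertex (m1 ** m') (vertex 0) = act_vertex (m1 ** m) (vertex 0)"
    by (simp add: act_vertex_mult assms(2))
  then have "act_vertex (m1 ** m') (vertex 0) = vertex 0"
    by (simp add: m1)
  then obtain k c where "k \<in> GL2_O" "c \<noteq> 0" "m1 ** m' = k ** scalar c"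
    by (rule stabilizer_vertex_0)
  moreover from this have "m' = m ** k ** scalar c"
    using m1 by (metis matrix_mul_assoc matrix_mul_lid)
  ultimately show ?thesis using that by blast
qed

text \<open>As \<open>v\<^sub>0\<close> is stabilized by \<open>GL\<^sub>2(\<O>)\<close> and scalars only, height \<open>n\<close> means that the matrix has the form \<open>\<gamma> diag(t\<^sup>n, 1) \<kappa> c\<close>.\<close>

lemma has_heightE:
  assumes "has_height m n"
  obtains \<gamma> k c where "\<gamma> \<in> GL2_poly" "k \<in> GL2_O" "c \<noteq> 0" "m = \<gamma> ** diag_t n ** k ** scalar c"
proof -
  obtain \<gamma> where \<gamma>: "\<gamma> \<in> GL2_poly" "act_vertex m (vertex 0) = act_vertex (\<gamma> ** diag_t n) (vertex 0)"
    using assms unfolding has_height_def vertex_conv[of n] act_vertex_mult by blast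
  have "det (\<gamma> ** diag_t n) \<noteq> 0"
    using GL2_poly_det[OF \<gamma>(1)] by (simp add: det_mul)
  from same_vertex[OF this \<gamma>(2)[symmetric]] show ?thesis
    using that \<gamma>(1) by blast
qed

text \<open>Two different vertices \<open>v\<^sub>n\<close>, \<open>v\<^sub>n\<^sub>'\<close> of the ray are inequivalent: if \<open>n' < n\<close>, a matrix carrying
  one to the other has a first column consisting of polynomials which would have negative degree, hence
  of zeros.\<close>

lemma has_height_unique:
  assumes "has_height m n" "has_height m n'" shows "n = n'"
proof -
  have le: "n \<le> n'" if nn: "has_height m n" "has_height m n'" for n n'
  proof (rule ccontr)
    assume "\<not> n \<le> n'"
    then have lt: "n' < n" by simp
    obtain \<gamma> \<gamma>' where g: "\<gamma> \<in> GL2_poly" "\<gamma>' \<in> GL2_poly"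
      "act_vertex m (vertex 0) = act_vertex \<gamma> (vertex n)"
      "act_vertex m (vertex 0) = act_vertex \<gamma>' (vertex n')"
      using nn unfolding has_height_def by blast
    obtain \<gamma>1 where g1: "\<gamma>1 \<in> GL2_poly" "\<gamma>1 ** \<gamma>' = mat 1"
      using GL2_poly_inverse[OF g(2)] .
    obtain a b c d where ab: "\<gamma>1 ** \<gamma> = mat2 a b c d" by (cases "\<gamma>1 ** \<gamma>")
    have abG: "mat2 a b c d \<in> GL2_poly"
      using g1 g(1) by (metis GL2_poly_mult ab)
    have "act_vertex (mat2 a b c d ** diag_t n) (vertex 0) = act_vertex (\<gamma>1 ** \<gamma>' ** diag_t n') (vertex 0)"
      using g(3,4) by (simp add: act_vertex_mult flip: ab vertex_conv)
    then have "act_vertex (diag_t n') (vertex 0) = act_vertex (mat2 a b c d ** diag_t n) (vertex 0)"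
      by (simp add: g1)
    then obtain k e where ke: "k \<in> GL2_O" "e \<noteq> 0" "mat2 a b c d ** diag_t n = diag_t n' ** k ** scalar e"
      by (rule same_vertex[rotated]) simp_all
    obtain p q r s where k: "k = mat2 p q r s" by (cases k)
    have "a * fls_X_inv ^ n = fls_X_inv ^ n' * p * e" "c * fls_X_inv ^ n = r * e"
      using ke(3) by (simp_all add: k diag_t_mat2 scalar_def)
    note eqs = this
    \<comment> \<open>Comparing determinants fixes the scalar: \<open>e\<close> has degree \<open>(n - n') / 2 > 0\<close>.\<close>
    have "det (mat2 a b c d) * fls_X_inv ^ n = fls_X_inv ^ n' * det k * (e * e)"
      using arg_cong[OF ke(3), of det] by (simp add: det_mul del: det_mat2)
    then have "fls_subdegree (det (mat2 a b c d) * fls_X_inv ^ n) =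
        fls_subdegree (fls_X_inv ^ n' * det k * (e * e))"
      by (simp only:)
    moreover have nz: "det k \<noteq> 0" "det (mat2 a b c d) \<noteq> 0"
      using GL2_O_det[OF ke(1)] GL2_poly_det[OF abG] by auto
    ultimately have "fls_subdegree (det (mat2 a b c d)) - int n = - int n' + fls_subdegree (det k) + 2 * fls_subdegree e"
      using ke(2) by (simp del: det_mat2)
    then have "- int n = - int n' + 2 * fls_subdegree e"
      using GL2_O_det(1)[OF ke(1)] GL2_poly_det(2)[OF abG] by simp
    then have ne: "int n' - int n = 2 * fls_subdegree e" by simp
    have O: "0 \<le> fls_subdegree p" "0 \<le> fls_subdegree r"
      using ke(1) unfolding k mat2_GL2_O by (auto simp: ring_O_iff)
    have "a = 0"
    proof (rule ccontr)
      assume "a \<noteq> 0"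
      then have "p \<noteq> 0" using eqs(1) by auto
      then have "fls_subdegree a - int n = - int n' + fls_subdegree p + fls_subdegree e"
        using arg_cong[OF eqs(1), of fls_subdegree] \<open>a \<noteq> 0\<close> ke(2) by simp
      then show False using GL2_poly_entries(1)[OF abG] O ne lt by linarith
    qed
    moreover have "c = 0"
    proof (rule ccontr)
      assume "c \<noteq> 0"
      then have "r \<noteq> 0" using eqs(2) by auto
      then have "fls_subdegree c - int n = fls_subdegree r + fls_subdegree e"
        using arg_cong[OF eqs(2), of fls_subdegree] \<open>c \<noteq> 0\<close> ke(2) by simp
      then show False using GL2_poly_entries(3)[OF abG] O ne lt by linarith
    qed
    ultimately show False using nz(2) by simp
  qed
  show ?thesis using le[of n n'] le[of n' n] assms by simp
qed

lemma height_eqI: "has_height m n \<Longrightarrow> height (act_vertex m (vertex 0)) = n"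
  unfolding height_def using has_height_unique unfolding has_height_def
  by (intro the_equality) blast+

section \<open>Neighbours of a vertex\<close>

text \<open>Right multiplication by \<open>down\<close> moves one step along the standard apartment, away from \<open>\<infinity>\<close>; together with \<open>diag(t, 1)\<close>, the
  matrices \<open>u(b) down\<close> for \<open>b \<in> \<F>\<^sub>q\<close> represent all neighbours of \<open>v\<^sub>0\<close>.\<close>

definition down :: "'a::{finite,field} mat2" where
  "down = mat2 fls_X 0 0 1"

lemma det_down [simp]: "det down = fls_X"
  by (simp add: down_def)

lemma diag_t_1_conv: "diag_t 1 = weyl ** down ** weyl ** scalar fls_X_inv"
  by (simp add: diag_t_mat2 down_def weyl_def scalar_def)

lemma diag_t_Suc_down: "diag_t (Suc n) ** down = diag_t n"
  by (simp add: diag_t_mat2 down_def mult.assoc)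

lemma diag_t_unip: "diag_t n ** unip s = unip (fls_X_inv ^ n * s) ** diag_t n"
  by (simp add: diag_t_mat2 unip_mat2)

lemma X_X_inv_cancel: "fls_X * (fls_X_inv * x) = (x :: 'a::field fls)"
  by (simp only: X_times_X_inv mult_1_left mult.assoc[symmetric])

text \<open>The matrix \<open>\<kappa>\<close> acts on the neighbours of \<open>v\<^sub>0\<close>, which are the lines of the residue plane; the line
  belonging to \<open>diag(\<pi>, 1)\<close> is spanned by the second basis vector. Its image is the line of \<open>diag(t, 1)\<close>
  exactly if the second column of \<open>\<kappa>\<close> reduces to a multiple of the first basis vector.\<close>

lemma GL2_O_down:
  fixes k :: "'a::{finite,field} mat2"
  assumes "k \<in> GL2_O"
  shows "k $ 2 $ 2 \<in> ring_O"
    and "fls_nth (k $ 2 $ 2) 0 = 0 \<Longrightarrow> act_vertex (k ** down) (vertex 0) = act_vertex (diag_t 1) (vertex 0)"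
    and "fls_nth (k $ 2 $ 2) 0 \<noteq> 0 \<Longrightarrow>
      \<exists>a. act_vertex (k ** down) (vertex 0) = act_vertex (unip (fls_const a) ** down) (vertex 0)"
proof -
  obtain p r p' s where k: "k = mat2 p r p' s" by (cases k)
  have O: "p \<in> ring_O" "r \<in> ring_O" "p' \<in> ring_O" "s \<in> ring_O" and u: "fls_nth (p * s - r * p') 0 \<noteq> 0"
    using assms unfolding k mat2_GL2_O by auto
  show "k $ 2 $ 2 \<in> ring_O" using O k by simp
  {
    assume "fls_nth (k $ 2 $ 2) 0 = 0"
    then have "fls_X_inv * s \<in> ring_O"
      using O by (intro ring_O_div_X) (simp_all add: k)
    moreover have *: "fls_X * p * (fls_X_inv * s) - r * p' = p * s - r * p'"
    proof -
      have "fls_X * p * (fls_X_inv * s) = (fls_X * fls_X_inv) * (p * s)"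
        by (simp only: mult_ac)
      then show ?thesis by simp
    qed
    ultimately have "mat2 (fls_X * p) r p' (fls_X_inv * s) \<in> GL2_O"
      using O u unfolding mat2_GL2_O * by (auto intro: ring_O_closed)
    moreover have "k ** down = diag_t 1 ** mat2 (fls_X * p) r p' (fls_X_inv * s) ** scalar fls_X"
    proof -
      have "fls_X_inv * (fls_X * p) * fls_X = (fls_X_inv * fls_X) * (p * fls_X)"
        "fls_X_inv * s * fls_X = (fls_X_inv * fls_X) * s" "fls_X_inv * r * fls_X = (fls_X_inv * fls_X) * r"
        by (simp_all only: mult_ac)
      then show ?thesis
        by (simp add: k down_def diag_t_mat2 scalar_def)
    qed
    ultimately show "act_vertex (k ** down) (vertex 0) = act_vertex (diag_t 1) (vertex 0)"
      by (simp add: act_scalar act_GL2_O)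
  }
  {
    assume s0: "fls_nth (k $ 2 $ 2) 0 \<noteq> 0"
    define a where "a = fls_nth r 0 / fls_nth s 0"
    define k' where "k' = mat2 (p - fls_const a * p') (fls_X_inv * (r - fls_const a * s)) (fls_X * p') s"
    have "fls_nth (r - fls_const a * s) 0 = 0"
      using s0 by (simp add: k a_def)
    then have 1: "fls_X_inv * (r - fls_const a * s) \<in> ring_O"
      using O by (intro ring_O_div_X ring_O_closed ring_O_const)
    have *: "(p - fls_const a * p') * s - fls_X_inv * (r - fls_const a * s) * (fls_X * p') = p * s - r * p'"
    proof -
      have "fls_X_inv * (r - fls_const a * s) * (fls_X * p') = (fls_X_inv * fls_X) * ((r - fls_const a * s) * p')"
        by (simp only: mult_ac)
      then show ?thesis by (simp add: algebra_simps)
    qed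
    have "k' \<in> GL2_O"
      using O u 1 unfolding k'_def mat2_GL2_O * by (auto intro!: ring_O_closed)
    moreover have "k ** down = unip (fls_const a) ** down ** k'"
      by (simp add: X_X_inv_cancel k k'_def down_def unip_mat2 algebra_simps)
    ultimately show "\<exists>a. act_vertex (k ** down) (vertex 0) = act_vertex (unip (fls_const a) ** down) (vertex 0)"
      by (metis act_GL2_O)
  }
qed

lemma has_height_diag_t_down:
  "has_height (diag_t n ** down :: 'a::{finite,field} mat2) (if n = 0 then 1 else n - 1)"
proof (cases n)
  case 0
  have eq: "diag_t n ** down = weyl ** (diag_t 1 ** weyl ** (scalar fls_X :: 'a mat2))"
    by (simp add: 0 diag_t_mat2 down_def weyl_def scalar_def)
  have "has_height (diag_t n ** down :: 'a mat2) 1 \<longleftrightarrow> has_height (diag_t 1 ** weyl ** scalar fls_X :: 'a mat2) 1"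
    unfolding eq by (rule has_height_left[OF weyl_GL2_poly])
  also have "\<dots> \<longleftrightarrow> has_height (diag_t 1 :: 'a mat2) 1"
    by (intro has_height_cong) (simp add: act_scalar act_GL2_O weyl_GL2_O)
  finally show ?thesis using 0 has_height_diag_t[of 1] by simp
next
  case (Suc n')
  then show ?thesis using has_height_diag_t[of n'] by (simp add: diag_t_Suc_down)
qed

text \<open>For \<open>n > 0\<close> only the direction of \<open>diag(t, 1)\<close> leads from \<open>v\<^sub>n\<close> up to \<open>v\<^sub>n\<^sub>+\<^sub>1\<close>. The neighbour of \<open>v\<^sub>n\<close> given by
  \<open>diag(t\<^sup>n, 1) u(a) down\<close> is moved to \<open>v\<^sub>n\<^sub>-\<^sub>1\<close> by the polynomial unipotent \<open>u(- a t\<^sup>n)\<close>. At \<open>n = 0\<close> the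
  reflection \<open>weyl\<close> makes both ends of the apartment look alike.\<close>

lemma has_height_neighbour:
  fixes \<gamma> :: "'a::{finite,field} mat2"
  assumes "\<gamma> \<in> GL2_poly" "k \<in> GL2_O"
  shows "has_height (\<gamma> ** diag_t n ** k ** down)
           (if fls_nth (k $ 2 $ 2) 0 = 0 \<or> n = 0 then n + 1 else n - 1)"
proof -
  have "has_height (diag_t n ** k ** down) (if fls_nth (k $ 2 $ 2) 0 = 0 \<or> n = 0 then n + 1 else n - 1)"
  proof (cases "fls_nth (k $ 2 $ 2) 0 = 0")
    case True
    then have "act_vertex (diag_t n ** k ** down) (vertex 0) = act_vertex (diag_t n ** diag_t 1) (vertex 0)"
      using GL2_O_down(2)[OF assms(2)] by (simp add: act_vertex_mult)
    moreover have "diag_t n ** diag_t 1 = (diag_t (n + 1) :: 'a mat2)"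
      by (simp add: diag_t_mat2 mult.commute)
    ultimately have "act_vertex (diag_t n ** k ** down) (vertex 0) = act_vertex (diag_t (n + 1)) (vertex 0)"
      by (simp only:)
    from has_height_cong[OF this] have "has_height (diag_t n ** k ** down) (n + 1)"
      using has_height_diag_t by blast
    then show ?thesis using True by simp
  next
    case False
    then obtain a where "act_vertex (k ** down) (vertex 0) = act_vertex (unip (fls_const a) ** down) (vertex 0)"
      using GL2_O_down(3)[OF assms(2)] by blast
    then have "act_vertex (diag_t n ** k ** down) (vertex 0) =
        act_vertex (diag_t n ** unip (fls_const a) ** down) (vertex 0)"
      by (simp add: act_vertex_mult)
    also have "diag_t n ** unip (fls_const a) ** down = unip (poly_at_t (monom a n)) ** (diag_t n ** down)"
      by (simp add: diag_t_unip poly_at_t_monom mult.commute matrix_mul_assoc)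
    finally have eq: "act_vertex (diag_t n ** k ** down) (vertex 0) =
        act_vertex (unip (poly_at_t (monom a n)) ** (diag_t n ** down)) (vertex 0)" .
    have "has_height (diag_t n ** k ** down) i \<longleftrightarrow> has_height (diag_t n ** down :: 'a mat2) i" for i
      unfolding has_height_cong[OF eq] by (rule has_height_left[OF unip_GL2_poly])
    then show ?thesis
      using False has_height_diag_t_down[of n] by (auto split: if_splits)
  qed
  then show ?thesis
    by (simp only: has_height_left[OF assms(1)] matrix_mul_assoc[symmetric])
qed

text \<open>The neighbours of a vertex of height \<open>n\<close> correspond to \<open>\<P>\<^sup>1(\<F>\<^sub>q)\<close>, and the linear form
  \<open>b \<mapsto> k\<^sub>1 b + k\<^sub>2\<close>, the bottom row of the residue of \<open>\<kappa>\<close>, vanishes for \<open>n > 0\<close> at the one neighbour of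
  height \<open>n + 1\<close>. The neighbour \<open>diag(t, 1)\<close> is the point \<open>\<infinity>\<close>, where vanishing means \<open>k\<^sub>1 = 0\<close>.\<close>

lemma neighbour_heights:
  fixes m :: "'a::{finite,field} mat2"
  assumes "has_height m n"
  obtains k1 k2 where "k1 \<noteq> 0 \<or> k2 \<noteq> 0"
    "has_height (m ** diag_t 1) (if k1 = 0 \<or> n = 0 then n + 1 else n - 1)"
    "\<And>b. has_height (m ** unip (fls_const b) ** down) (if k1 * b + k2 = 0 \<or> n = 0 then n + 1 else n - 1)"
proof -
  obtain \<gamma> k c where m: "\<gamma> \<in> GL2_poly" "k \<in> GL2_O" "c \<noteq> 0" "m = \<gamma> ** diag_t n ** k ** scalar c"
    using has_heightE[OF assms] .
  obtain p r p' s where k: "k = mat2 p r p' s" by (cases k)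
  have O: "p \<in> ring_O" "r \<in> ring_O" "p' \<in> ring_O" "s \<in> ring_O" and u: "fls_nth (p * s - r * p') 0 \<noteq> 0"
    using m(2) unfolding k mat2_GL2_O by auto
  have "fls_nth p' 0 \<noteq> 0 \<or> fls_nth s 0 \<noteq> 0"
  proof (rule ccontr)
    assume "\<not> ?thesis"
    then have "fls_nth (p * s - r * p') 0 = 0"
      using O by (simp add: residue_mult)
    then show False using u by simp
  qed
  moreover have "has_height (m ** diag_t 1) (if fls_nth p' 0 = 0 \<or> n = 0 then n + 1 else n - 1)"
  proof -
    have "m ** diag_t 1 = m ** (weyl ** down ** weyl) ** scalar fls_X_inv"
      by (simp only: diag_t_1_conv matrix_mul_assoc)
    then have "act_vertex (m ** diag_t 1) (vertex 0) = act_vertex (m ** (weyl ** down ** weyl)) (vertex 0)"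
      by (simp only: act_scalar[OF fls_X_inv_nonzero])
    also have "m ** (weyl ** down ** weyl) = \<gamma> ** diag_t n ** k ** (weyl ** down ** weyl) ** scalar c"
      unfolding m(4) by (rule scalar_commute_right)
    also have "act_vertex \<dots> (vertex 0) = act_vertex (\<gamma> ** diag_t n ** (k ** weyl) ** down ** weyl) (vertex 0)"
      by (simp only: act_scalar[OF m(3)] matrix_mul_assoc)
    also have "\<dots> = act_vertex (\<gamma> ** diag_t n ** (k ** weyl) ** down) (vertex 0)"
      by (rule act_GL2_O[OF weyl_GL2_O])
    finally have eq: "has_height (m ** diag_t 1) i \<longleftrightarrow> has_height (\<gamma> ** diag_t n ** (k ** weyl) ** down) i" for i
      by (rule has_height_cong)
    moreover have "(k ** weyl) $ 2 $ 2 = p'"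
      by (simp add: k weyl_def)
    ultimately show ?thesis
      using has_height_neighbour[OF m(1) GL2_O_mult[OF m(2) weyl_GL2_O], of n] by (simp only: eq)
  qed
  moreover have "has_height (m ** unip (fls_const b) ** down)
      (if fls_nth p' 0 * b + fls_nth s 0 = 0 \<or> n = 0 then n + 1 else n - 1)" for b
  proof -
    have "m ** (unip (fls_const b) ** down) = \<gamma> ** diag_t n ** k ** (unip (fls_const b) ** down) ** scalar c"
      unfolding m(4) by (rule scalar_commute_right)
    then have "act_vertex (m ** unip (fls_const b) ** down) (vertex 0) =
        act_vertex (\<gamma> ** diag_t n ** (k ** unip (fls_const b)) ** down) (vertex 0)"
      by (metis act_scalar[OF m(3)] matrix_mul_assoc)
    then have eq: "has_height (m ** unip (fls_const b) ** down) i \<longleftrightarrow>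
        has_height (\<gamma> ** diag_t n ** (k ** unip (fls_const b)) ** down) i" for i
      by (rule has_height_cong)
    moreover have "fls_nth ((k ** unip (fls_const b)) $ 2 $ 2) 0 = fls_nth p' 0 * b + fls_nth s 0"
      by (simp add: k unip_mat2)
    ultimately show ?thesis
      using has_height_neighbour[OF m(1) GL2_O_mult[OF m(2) unip_GL2_O[OF ring_O_const[of b]]], of n]
      by (simp only: eq)
  qed
  ultimately show ?thesis by (rule that)
qed

lemma X_pow_cancel: "fls_X_inv ^ N * (fls_X ^ N * f) = (f :: 'a::field fls)"
  "fls_X ^ N * (fls_X_inv ^ N * f) = f"
  by (simp_all flip: mult.assoc power_mult_distrib)

section \<open>Every vertex has a height\<close>

definition diag_pow :: "int \<Rightarrow> 'a::{finite,field} mat2" where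
  "diag_pow i = mat2 (fls_X_inv powi i) 0 0 1"

text \<open>Far enough towards \<open>\<infinity>\<close> the geodesic from \<open>s\<close> to \<open>\<infinity>\<close> agrees with the ray of the \<open>v\<^sub>n\<close>, and heights
  propagate to neighbours on the way back.\<close>

lemma has_height_horospherical: "\<exists>n. has_height (unip s ** diag_pow i) n"
proof -
  \<comment> \<open>The level \<open>K\<close> is at least \<open>i\<close> and so large that \<open>s \<in> t\<^sup>K \<O>\<close>.\<close>
  define K where "K = nat (max i (- fls_subdegree s))"
  have "i \<le> int K"
    unfolding K_def by linarith
  then show ?thesis
  proof (induction i rule: int_le_induct)
    case base
    have "fls_X ^ K * s \<in> ring_O"
      by (cases "s = 0") (auto simp: ring_O_iff K_def)
    moreover have "unip s ** diag_pow (int K) = diag_t K ** unip (fls_X ^ K * s)"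
      by (simp add: diag_t_unip X_pow_cancel) (simp add: diag_pow_def diag_t_mat2)
    ultimately have "act_vertex (unip s ** diag_pow (int K)) (vertex 0) = act_vertex (diag_t K) (vertex 0)"
      by (simp add: act_GL2_O unip_GL2_O)
    then show ?case
      using has_height_cong has_height_diag_t by blast
  next
    case (step i)
    then obtain n where n: "has_height (unip s ** diag_pow i) n" by blast
    have "unip s ** diag_pow (i - 1) = unip s ** diag_pow i ** unip (fls_const 0) ** down"
      by (simp add: unip_mat2 diag_pow_def down_def power_int_diff fls_X_times_conv_shift)
    then show ?case
      using neighbour_heights[OF n] by metis
  qed
qed

text \<open>The Iwasawa decomposition reduces everything to the horospherical vertices: dividing the bottom row by its larger entry gives
  an integral column operation which makes the matrix upper triangular.\<close>

lemma exists_height: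
  assumes "det m \<noteq> 0" shows "\<exists>n. has_height m n"
proof -
  obtain a b c d where m: "m = mat2 a b c d" by (cases m)
  have "\<exists>k p r s. k \<in> GL2_O \<and> m ** k = mat2 p r 0 s"
  proof (cases "d \<noteq> 0 \<and> c / d \<in> ring_O")
    case True
    then have "mat2 1 0 (- (c / d)) 1 \<in> GL2_O"
      by (simp add: mat2_GL2_O)
    moreover have "m ** mat2 1 0 (- (c / d)) 1 = mat2 (a - b * (c / d)) b 0 d"
      using True by (simp add: m)
    ultimately show ?thesis by blast
  next
    case False
    have "c \<noteq> 0"
      using False assms m by auto
    moreover have "d / c \<in> ring_O"
      using False \<open>c \<noteq> 0\<close> by (cases "d = 0") (auto simp: ring_O_iff fls_divide_subdegree)
    ultimately have "mat2 (- (d / c)) 1 1 0 \<in> GL2_O"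
      by (simp add: mat2_GL2_O)
    moreover have "m ** mat2 (- (d / c)) 1 1 0 = mat2 (b - a * (d / c)) a 0 c"
      using \<open>c \<noteq> 0\<close> by (simp add: m)
    ultimately show ?thesis by blast
  qed
  then obtain k p r s where k: "k \<in> GL2_O" "m ** k = mat2 p r 0 s" by blast
  have "det (mat2 p r 0 s) \<noteq> 0"
    using assms GL2_O_det(2)[OF k(1)] by (simp add: det_mul flip: k(2) del: det_mat2)
  then have ps: "p \<noteq> 0" "s \<noteq> 0" by auto
  define i where "i = - fls_subdegree (p / s)"
  define u where "u = p / s / fls_X_inv powi i"
  have u: "fls_subdegree u = 0" "u \<noteq> 0"
    using ps by (auto simp: u_def i_def fls_divide_subdegree)
  have "mat2 u 0 0 1 \<in> GL2_O"
    using u nth_fls_subdegree_nonzero[of u] by (simp add: mat2_GL2_O ring_O_iff)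
  moreover have "mat2 p r 0 s = unip (r / s) ** diag_pow i ** mat2 u 0 0 1 ** scalar s"
    using ps by (simp add: unip_mat2 diag_pow_def scalar_def u_def)
  ultimately have "act_vertex m (vertex 0) = act_vertex (unip (r / s) ** diag_pow i) (vertex 0)"
    using ps k by (metis act_GL2_O act_scalar)
  then show ?thesis
    using has_height_horospherical has_height_cong by metis
qed

definition hgt :: "'a::{finite,field} mat2 \<Rightarrow> nat" where
  "hgt m = height (act_vertex m (vertex 0))"

lemma hgt_iff: "det m \<noteq> 0 \<Longrightarrow> has_height m n \<longleftrightarrow> hgt m = n"
  unfolding hgt_def using exists_height height_eqI by blast

lemma hgt_left: "\<gamma> \<in> GL2_poly \<Longrightarrow> hgt (\<gamma> ** m) = hgt m"
  unfolding hgt_def height_def has_height_def[symmetric] by (simp add: has_height_left)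

section \<open>Heights along horospheres\<close>

lemma unip_0: "unip 0 = mat 1" and diag_t_0: "diag_t 0 = mat 1"
  by (simp_all add: unip_mat2 diag_t_mat2 mat_1_mat2)

text \<open>The vertices \<open>g u(s) v\<^sub>N\<close> with \<open>N \<ge> 0\<close> form the ray from \<open>g u(s) v\<^sub>0\<close> to \<open>g\<infinity>\<close>. Decreasing \<open>N\<close> is one
  step of the walk whose final height, at \<open>N = 0\<close>, is averaged.\<close>

definition walk :: "'a::{finite,field} mat2 \<Rightarrow> nat \<Rightarrow> 'a fls \<Rightarrow> nat" where
  "walk g N s = hgt (g ** unip s ** diag_t N)"

text \<open>Both \<open>h_K\<close> and \<open>k_height\<close> are descriptions of this form, with \<open>m\<close> trivial or diagonal.\<close>

lemma hgt_coset: "(THE n. \<forall>g'\<in>coset g. n = hgt (g' ** m)) = hgt (g ** m)"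
proof (rule the_equality)
  have "(mat 1 :: 'a poly ^ 2 ^ 2) \<in> {M. det M = 1}" by simp
  then have "(mat 1 :: 'a mat2) \<in> SL2_poly"
    unfolding SL2_poly_def by (rule image_eqI[rotated]) (simp add: mat_at_t_1)
  then have "g \<in> coset g"
    unfolding coset_def by (rule image_eqI[rotated]) simp
  then show "n = hgt (g ** m)" if "\<forall>g'\<in>coset g. n = hgt (g' ** m)" for n
    using that by blast
  show "\<forall>g'\<in>coset g. hgt (g ** m) = hgt (g' ** m)"
    using SL2_poly_subset_GL2_poly
    by (auto simp: coset_def hgt_left subset_iff simp flip: matrix_mul_assoc)
qed

lemma k_height_walk: "k_height (coset g) N = walk g N 0"
  using hgt_coset[of g "diag_t N"]
  by (simp add: k_height_def walk_def hgt_def act_vertex_mult unip_0)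

lemma h_K_walk: "h_K (right_translate (coset g) (unip s)) = walk g 0 s"
proof -
  have "right_translate (coset g) (unip s) = coset (g ** unip s)"
    by (simp add: right_translate_def coset_def image_image matrix_mul_assoc)
  then show ?thesis
    using hgt_coset[of "g ** unip s" "mat 1"]
    by (simp add: h_K_def walk_def hgt_def diag_t_0)
qed

lemma tpow_O_iff: "s \<in> tpow_O N \<longleftrightarrow> fls_X ^ N * s \<in> ring_O"
proof
  show "s \<in> tpow_O N \<Longrightarrow> fls_X ^ N * s \<in> ring_O"
    by (auto simp: tpow_O_def X_pow_cancel)
  show "fls_X ^ N * s \<in> ring_O \<Longrightarrow> s \<in> tpow_O N"
    unfolding tpow_O_def by (rule image_eqI[where x = "fls_X ^ N * s"]) (simp_all add: X_pow_cancel)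
qed

lemma walk_coset:
  assumes "s' - s \<in> tpow_O N" shows "walk g N s' = walk g N s"
proof -
  have "fls_X_inv ^ N * (fls_X ^ N * (s' - s)) = s' - s"
    by (simp add: X_pow_cancel)
  then have "unip s ** (diag_t N ** unip (fls_X ^ N * (s' - s))) = unip s ** unip (s' - s) ** diag_t N"
    by (simp only: diag_t_unip matrix_mul_assoc)
  also have "\<dots> = unip s' ** diag_t N"
    by (simp add: unip_mult)
  finally have "g ** unip s' ** diag_t N = g ** unip s ** diag_t N ** unip (fls_X ^ N * (s' - s))"
    by (simp only: matrix_mul_assoc[symmetric])
  then show ?thesis
    using assms by (simp add: walk_def hgt_def tpow_O_iff act_GL2_O unip_GL2_O)
qed

text \<open>In the reduced form \<open>\<gamma> diag(t\<^sup>n, 1) \<kappa> c\<close> the determinant has degree \<open>n\<close> up to twice the degree of \<open>c\<close>, and here it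
  has degree \<open>N\<close>.\<close>

lemma walk_even:
  assumes "g \<in> SL2_F" shows "even (walk g N s + N)"
proof -
  define m where "m = g ** unip s ** diag_t N"
  have det: "det m = fls_X_inv ^ N"
    using assms by (simp add: m_def det_mul SL2_F_def)
  then have "has_height m (walk g N s)"
    by (simp add: hgt_iff walk_def m_def)
  then obtain \<gamma> k c where m: "\<gamma> \<in> GL2_poly" "k \<in> GL2_O" "c \<noteq> 0"
      "m = \<gamma> ** diag_t (walk g N s) ** k ** scalar c"
    by (rule has_heightE)
  have "fls_X_inv ^ N = det \<gamma> * fls_X_inv ^ walk g N s * det k * (c * c)"
    using det unfolding m(4) det_mul by simp
  then have "fls_subdegree (fls_X_inv ^ N :: 'a fls) = fls_subdegree (det \<gamma> * fls_X_inv ^ walk g N s * det k * (c * c))"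
    by (simp only:)
  then have "- int N = - int (walk g N s) + 2 * fls_subdegree c"
    using GL2_poly_det[OF m(1)] GL2_O_det[OF m(2)] m(3) by simp
  then show ?thesis by presburger
qed

text \<open>The child \<open>b\<close> of the vertex with parameters \<open>(N, s)\<close> has parameters \<open>(N - 1, s + b t\<^sup>N)\<close>, since conjugating \<open>u(b)\<close> by
  \<open>diag(t\<^sup>N, 1)\<close> gives \<open>u(b t\<^sup>N)\<close>.\<close>

lemma walk_neighbours:
  fixes g :: "'a::{finite,field} mat2"
  assumes "det g \<noteq> 0"
  obtains k1 k2 where "k1 \<noteq> 0 \<or> k2 \<noteq> 0"
    "walk g (Suc N) s = (if k1 = 0 \<or> walk g N s = 0 then walk g N s + 1 else walk g N s - 1)"
    "\<And>b M. N = Suc M \<Longrightarrow> walk g M (s + fls_const b * fls_X_inv ^ N) =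
       (if k1 * b + k2 = 0 \<or> walk g N s = 0 then walk g N s + 1 else walk g N s - 1)"
proof -
  define m where "m = g ** unip s ** diag_t N"
  have det: "det m \<noteq> 0"
    using assms by (simp add: m_def det_mul)
  then have "has_height m (walk g N s)"
    by (simp add: hgt_iff walk_def m_def)
  then obtain k1 k2 where k: "k1 \<noteq> 0 \<or> k2 \<noteq> 0"
    "has_height (m ** diag_t 1) (if k1 = 0 \<or> walk g N s = 0 then walk g N s + 1 else walk g N s - 1)"
    "\<And>b. has_height (m ** unip (fls_const b) ** down)
      (if k1 * b + k2 = 0 \<or> walk g N s = 0 then walk g N s + 1 else walk g N s - 1)"
    by (rule neighbour_heights) blast
  have det': "det (m ** diag_t 1) \<noteq> 0" "det (m ** unip (fls_const b) ** down) \<noteq> 0" for b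
    using det by (simp_all add: det_mul)
  have "diag_t N ** diag_t 1 = (diag_t (Suc N) :: 'a mat2)"
    by (simp add: diag_t_mat2 mult.commute)
  then have 1: "walk g (Suc N) s = hgt (m ** diag_t 1)"
    by (simp add: walk_def m_def flip: matrix_mul_assoc)
  have 2: "walk g M (s + fls_const b * fls_X_inv ^ N) = hgt (m ** unip (fls_const b) ** down)" if "N = Suc M" for b M
  proof -
    have "m ** unip (fls_const b) ** down = g ** unip s ** (diag_t N ** unip (fls_const b)) ** down"
      by (simp only: m_def matrix_mul_assoc)
    also have "\<dots> = g ** (unip s ** unip (fls_X_inv ^ N * fls_const b)) ** (diag_t N ** down)"
      by (simp only: diag_t_unip matrix_mul_assoc)
    finally show ?thesis
      by (simp only: walk_def unip_mult that diag_t_Suc_down mult.commute)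
  qed
  show ?thesis
    using that[OF k(1)] k(2,3) unfolding 1 using 2 det' by (simp add: hgt_iff)
qed

section \<open>Haar measure of unions of cosets of \<open>\<O>\<close>\<close>

definition ball_t :: "nat \<Rightarrow> 'a::{finite,field} fls \<Rightarrow> 'a fls set" where
  "ball_t N s = {x. x - s \<in> tpow_O N}"

definition O_invariant :: "'a::{finite,field} fls set \<Rightarrow> bool" where
  "O_invariant A \<longleftrightarrow> (\<forall>x y. x \<in> A \<longrightarrow> y - x \<in> ring_O \<longrightarrow> y \<in> A)"

lemma tpow_O_subdegree: "x \<in> tpow_O N \<longleftrightarrow> - int N \<le> fls_subdegree x"
  by (cases "x = 0") (auto simp: tpow_O_iff ring_O_iff)

lemma tpow_O_0 [simp]: "tpow_O 0 = ring_O"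
  by (auto simp: tpow_O_iff)

text \<open>Elements at distance less than \<open>1\<close> differ by an element of \<open>\<O>\<close>, so such sets are open.\<close>

lemma O_invariant_borel:
  assumes "O_invariant A" shows "A \<in> sets borel"
proof -
  have "open A"
    unfolding open_fls_def
  proof (intro ballI exI conjI subsetI)
    fix x y assume "x \<in> A" "y \<in> {y. dist y x < 1}"
    then have "dist y x < 1" by simp
    moreover have "1 \<le> (2 :: real) ^ n" for n :: nat
      by simp
    ultimately have "y - x \<in> ring_O"
      by (auto simp: dist_fls_def ring_O_iff not_less[symmetric] split: if_splits)
    then show "y \<in> A"
      using assms \<open>x \<in> A\<close> by (auto simp: O_invariant_def)
  qed simp
  then show ?thesis by (rule borel_open)
qed

lemma tpow_O_add: "x \<in> tpow_O N \<Longrightarrow> y \<in> tpow_O N \<Longrightarrow> x + y \<in> tpow_O N"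
  by (auto simp: tpow_O_iff distrib_left intro: ring_O_add)

lemma ring_O_tpow_O: "x \<in> ring_O \<Longrightarrow> x \<in> tpow_O N"
  by (simp add: tpow_O_subdegree ring_O_iff)

lemma O_invariant_ball_t: "O_invariant (ball_t N s)"
  unfolding O_invariant_def ball_t_def
proof (intro allI impI CollectI)
  fix x y assume "x \<in> {x. x - s \<in> tpow_O N}" "y - x \<in> ring_O"
  then have "(x - s) + (y - x) \<in> tpow_O N"
    by (intro tpow_O_add) (simp_all add: ring_O_tpow_O)
  then show "y - s \<in> tpow_O N" by simp
qed

lemma O_invariant_Int: "O_invariant A \<Longrightarrow> O_invariant B \<Longrightarrow> O_invariant (A \<inter> B)"
  unfolding O_invariant_def by blast

lemma digit_in_tpow_O: "fls_const b * fls_X_inv ^ N \<in> tpow_O N"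
  by (simp add: tpow_O_iff mult.commute[of "fls_const b"] X_pow_cancel)

text \<open>The \<open>q\<close> pieces of the ball correspond to the children of its vertex.\<close>

lemma ball_t_Suc: "ball_t (Suc N) s = (\<Union>b. ball_t N (s + fls_const b * fls_X_inv ^ Suc N))"
proof (intro subset_antisym subsetI)
  fix x assume "x \<in> ball_t (Suc N) s"
  define y where "y = fls_X ^ Suc N * (x - s)"
  have y: "y \<in> ring_O"
    using \<open>x \<in> ball_t (Suc N) s\<close> by (simp add: ball_t_def tpow_O_iff y_def)
  \<comment> \<open>The digit \<open>b\<close> is the coefficient of \<open>t\<^bsup>N+1\<^esup>\<close> in \<open>x - s\<close>.\<close>
  define b where "b = fls_nth y 0"
  have "fls_X_inv * (y - fls_const b) \<in> ring_O"
    using y by (intro ring_O_div_X) (simp_all add: ring_O_diff b_def)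
  moreover have "fls_X_inv * y = fls_X ^ N * (x - s)"
    using X_pow_cancel(1)[of 1] by (simp add: y_def mult.assoc)
  moreover have "fls_X_inv * fls_const b = fls_X ^ N * (fls_const b * fls_X_inv ^ Suc N)"
  proof -
    have "fls_X ^ N * (fls_const b * fls_X_inv ^ Suc N) = fls_X ^ N * (fls_X_inv ^ N * (fls_X_inv * fls_const b))"
      by (simp only: power_Suc mult_ac)
    then show ?thesis by (simp only: X_pow_cancel)
  qed
  ultimately have "fls_X ^ N * (x - (s + fls_const b * fls_X_inv ^ Suc N)) \<in> ring_O"
    by (simp add: right_diff_distrib distrib_left diff_diff_eq)
  then show "x \<in> (\<Union>b. ball_t N (s + fls_const b * fls_X_inv ^ Suc N))"
    unfolding ball_t_def tpow_O_iff by blast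
next
  fix x assume "x \<in> (\<Union>b. ball_t N (s + fls_const b * fls_X_inv ^ Suc N))"
  then obtain b where "x - (s + fls_const b * fls_X_inv ^ Suc N) \<in> tpow_O N"
    by (auto simp: ball_t_def)
  then have "x - (s + fls_const b * fls_X_inv ^ Suc N) \<in> tpow_O (Suc N)"
    by (simp add: tpow_O_subdegree)
  from tpow_O_add[OF this digit_in_tpow_O[of b "Suc N"]] show "x \<in> ball_t (Suc N) s"
    by (simp add: ball_t_def diff_diff_eq[symmetric] del: power_Suc)
qed

lemma ball_t_disjoint:
  assumes "x \<in> ball_t N (s + fls_const b * fls_X_inv ^ Suc N)"
    "x \<in> ball_t N (s + fls_const c * fls_X_inv ^ Suc N)"
  shows "b = c"
proof (rule ccontr)
  assume "b \<noteq> c"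
  have "(x - (s + fls_const b * fls_X_inv ^ Suc N)) + - (x - (s + fls_const c * fls_X_inv ^ Suc N)) \<in> tpow_O N"
    using assms by (intro tpow_O_add) (simp_all add: ball_t_def tpow_O_subdegree del: power_Suc minus_diff_eq)
  moreover have "(x - (s + fls_const b * fls_X_inv ^ Suc N)) + - (x - (s + fls_const c * fls_X_inv ^ Suc N))
      = fls_const (c - b) * fls_X_inv ^ Suc N"
    by (simp add: left_diff_distrib flip: fls_minus_const del: power_Suc)
  ultimately have "- int N \<le> fls_subdegree (fls_const (c - b) * fls_X_inv ^ Suc N)"
    by (simp add: tpow_O_subdegree del: power_Suc)
  moreover have "fls_const (c - b) \<noteq> 0"
    using \<open>b \<noteq> c\<close> by simp
  ultimately show False by (simp del: power_Suc)
qed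

lemma emeasure_ball_t_Suc:
  assumes "normalized_haar \<mu>" "O_invariant A"
  shows "emeasure \<mu> (ball_t (Suc N) s \<inter> A) =
    (\<Sum>b\<in>UNIV. emeasure \<mu> (ball_t N (s + fls_const b * fls_X_inv ^ Suc N) \<inter> A))"
proof -
  have "sets \<mu> = sets borel"
    using assms(1) by (simp add: normalized_haar_def)
  then have "range (\<lambda>b. ball_t N (s + fls_const b * fls_X_inv ^ Suc N) \<inter> A) \<subseteq> sets \<mu>"
    using assms(2) by (auto intro!: O_invariant_borel O_invariant_Int O_invariant_ball_t)
  moreover have "disjoint_family (\<lambda>b. ball_t N (s + fls_const b * fls_X_inv ^ Suc N) \<inter> A)"
    unfolding disjoint_family_on_def using ball_t_disjoint by blast
  ultimately have "(\<Sum>b\<in>UNIV. emeasure \<mu> (ball_t N (s + fls_const b * fls_X_inv ^ Suc N) \<inter> A)) =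
      emeasure \<mu> (\<Union>b. ball_t N (s + fls_const b * fls_X_inv ^ Suc N) \<inter> A)"
    by (intro sum_emeasure) auto
  then show ?thesis
    by (simp add: ball_t_Suc[of N s])
qed

lemma emeasure_ball_t_0:
  assumes "normalized_haar \<mu>" shows "emeasure \<mu> (ball_t 0 s) = 1"
proof -
  have "ball_t 0 s = (\<lambda>x. s + x) ` ring_O"
    unfolding ball_t_def by (auto intro: image_eqI[where x = "_ - s"])
  moreover have "(ring_O :: 'a fls set) \<in> sets borel"
    using O_invariant_borel[OF O_invariant_ball_t[of 0 0]] by (simp add: ball_t_def)
  ultimately show ?thesis
    using assms by (simp add: normalized_haar_def)
qed

lemma emeasure_ball_t:
  fixes \<mu> :: "'a::{finite,field} fls measure"
  assumes "normalized_haar \<mu>" shows "emeasure \<mu> (ball_t N s) = of_nat (CARD('a) ^ N)"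
proof (induction N arbitrary: s)
  case (Suc N)
  show ?case
    using emeasure_ball_t_Suc[OF assms, of UNIV N s] Suc.IH by (simp add: O_invariant_def)
qed (simp add: emeasure_ball_t_0[OF assms])

section \<open>Counting the leaves of large height\<close>

text \<open>Out of the \<open>q\<^sup>N\<close> walks of length \<open>N\<close> which start at height \<open>n\<close>, the number of those that end at height at
  least \<open>2k\<close>, where \<open>k \<ge> 1\<close> and \<open>n + N\<close> is even. The first function is for walks that arrive at their
  starting vertex from height \<open>n + 1\<close>, the second for those that arrive from height \<open>n - 1\<close>. The value
  \<open>q\<^bsup>N+1-2k\<^esup>\<close> is that of the limit distribution.\<close>

definition tail_from_above :: "nat \<Rightarrow> nat \<Rightarrow> nat \<Rightarrow> nat \<Rightarrow> nat" where
  "tail_from_above q n N k =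
     (if 2 * k + N \<le> n then q ^ N else if 2 * k + n \<le> N then q ^ (N + 1 - 2 * k) else 0)"

definition tail_from_below :: "nat \<Rightarrow> nat \<Rightarrow> nat \<Rightarrow> nat \<Rightarrow> nat" where
  "tail_from_below q n N k =
     (if n + N < 2 * k then 0 else if 2 * k + N \<le> n then q ^ N
      else if 2 * k + n \<le> N then q ^ (N + 1 - 2 * k) else q ^ ((n + N) div 2 - k))"

lemma power_Suc_diff: "b \<le> N \<Longrightarrow> q ^ (Suc N - b) = q * (q :: nat) ^ (N - b)"
  by (simp add: Suc_diff_le)

text \<open>The three recursions are the possible first steps: from height \<open>0\<close> the walk must go up, a walk that came from above
  must go down, and one that came from below has one way up and \<open>q - 1\<close> ways down.\<close>

lemma tail_from_above_0_Suc:
  assumes "k \<ge> 1" "odd N" shows "tail_from_above q 0 (Suc N) k = q * tail_from_below q 1 N k"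
proof -
  obtain M where M: "N = 2 * M + 1" using assms(2) by (rule oddE)
  have "2 * k + 1 \<le> N \<or> 2 * k = Suc N \<or> Suc N < 2 * k"
    using M by presburger
  then show ?thesis
  proof (elim disjE)
    assume "2 * k + 1 \<le> N"
    then show ?thesis
      using assms(1) power_Suc_diff[of "2 * k" "Suc N" q] by (simp add: tail_from_above_def tail_from_below_def)
  qed (use assms(1) M in \<open>auto simp: tail_from_above_def tail_from_below_def\<close>)
qed

lemma tail_from_above_Suc_Suc: "tail_from_above q (Suc n) (Suc N) k = q * tail_from_above q n N k"
  using power_Suc_diff[of "2 * k" "Suc N" q] by (auto simp: tail_from_above_def)

lemma tail_from_below_Suc:
  assumes "k \<ge> 1" "odd (n + N)" "n \<ge> 1" "q \<ge> 1"
  shows "tail_from_below q n (Suc N) k = tail_from_below q (Suc n) N k + (q - 1) * tail_from_above q (n - 1) N k"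
proof -
  have q: "x + (q - 1) * x = q * x" for x :: nat
    using assms(4) by (cases q) simp_all
  obtain M where M: "n + N = 2 * M + 1" using assms(2) by (rule oddE)
  have "n + Suc N < 2 * k \<or> 2 * k + Suc N \<le> n \<or> 2 * k + n < N \<or> 2 * k + n = Suc N
      \<or> (2 * k \<le> n + Suc N \<and> n < 2 * k + Suc N \<and> Suc N < 2 * k + n)"
    using M by presburger
  then show ?thesis
  proof (elim disjE)
    assume *: "2 * k + Suc N \<le> n"
    then have "2 * k + N \<le> n - 1" by linarith
    with * show ?thesis using assms q by (simp add: tail_from_below_def tail_from_above_def)
  next
    assume *: "2 * k + n < N"
    then have "\<not> 2 * k + N \<le> n - 1" "2 * k + (n - 1) \<le> N" by linarith+
    with * show ?thesis
      using assms q power_Suc_diff[of "2 * k" "Suc N" q] by (simp add: tail_from_below_def tail_from_above_def)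
  next
    assume *: "2 * k + n = Suc N"
    then have "Suc n + N = 2 * (Suc N - k)"
      using assms(3) by linarith
    then have "(Suc n + N) div 2 - k = Suc N - 2 * k"
      by simp
    moreover have "\<not> 2 * k + N \<le> n - 1" "2 * k + (n - 1) \<le> N"
      using * assms(1,3) by linarith+
    ultimately show ?thesis
      using * assms q power_Suc_diff[of "2 * k" "Suc N" q] by (simp add: tail_from_below_def tail_from_above_def)
  next
    assume *: "2 * k \<le> n + Suc N \<and> n < 2 * k + Suc N \<and> Suc N < 2 * k + n"
    moreover have "\<not> 2 * k + N \<le> n - 1" "\<not> 2 * k + (n - 1) \<le> N"
      using * assms(1,3) by linarith+
    moreover have "(n + Suc N) div 2 - k = N" if "2 * k + N \<le> Suc n"
    proof -
      have "n + Suc N = 2 * (k + N)"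
        using * M that by presburger
      then show ?thesis by simp
    qed
    ultimately show ?thesis by (auto simp: tail_from_below_def tail_from_above_def)
  qed (use assms in \<open>auto simp: tail_from_below_def tail_from_above_def\<close>)
qed

definition high :: "'a::{finite,field} mat2 \<Rightarrow> nat \<Rightarrow> 'a fls set" where
  "high g k = {x. 2 * k \<le> walk g 0 x}"

lemma O_invariant_high: "O_invariant (high g k)"
  unfolding O_invariant_def high_def
  by (metis (mono_tags, lifting) mem_Collect_eq tpow_O_0 walk_coset)

text \<open>Induction on the number of steps, splitting the ball into those of the \<open>q\<close> children. The walk
  arrives at each child from the vertex of height \<open>n\<close> just left, so the child falls into one of the two cases.\<close>

lemma emeasure_high:
  fixes g :: "'a::{finite,field} mat2"
  assumes "normalized_haar \<mu>" "g \<in> SL2_F" "k \<ge> 1"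
  shows "(walk g (Suc N) s = walk g N s + 1 \<longrightarrow>
      emeasure \<mu> (ball_t N s \<inter> high g k) = of_nat (tail_from_above CARD('a) (walk g N s) N k)) \<and>
    (walk g (Suc N) s + 1 = walk g N s \<longrightarrow>
      emeasure \<mu> (ball_t N s \<inter> high g k) = of_nat (tail_from_below CARD('a) (walk g N s) N k))"
proof (induction N arbitrary: s)
  case 0
  have "walk g 0 x = walk g 0 s" if "x \<in> ball_t 0 s" for x
    using that unfolding ball_t_def by (intro walk_coset) simp
  then have "ball_t 0 s \<inter> high g k = (if 2 * k \<le> walk g 0 s then ball_t 0 s else {})"
    by (auto simp: high_def)
  then have "emeasure \<mu> (ball_t 0 s \<inter> high g k) = (if 2 * k \<le> walk g 0 s then 1 else 0)"
    using emeasure_ball_t_0[OF assms(1)] by simp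
  then show ?case
    using assms(3) by (simp add: tail_from_above_def tail_from_below_def)
next
  case (Suc N)
  define n where "n = walk g (Suc N) s"
  define c where "c b = s + fls_const b * fls_X_inv ^ Suc N" for b
  have det: "det g \<noteq> 0"
    using assms(2) by (simp add: SL2_F_def)
  have par: "walk g (Suc N) (c b) = n" for b
    unfolding n_def by (rule walk_coset) (simp add: c_def digit_in_tpow_O del: power_Suc)
  have odd: "odd (n + N)"
    using walk_even[OF assms(2), of "Suc N" s] by (simp add: n_def)
  obtain k1 k2 where k: "k1 \<noteq> 0 \<or> k2 \<noteq> 0"
    "walk g (Suc (Suc N)) s = (if k1 = 0 \<or> n = 0 then n + 1 else n - 1)"
    "\<And>b. walk g N (c b) = (if k1 * b + k2 = 0 \<or> n = 0 then n + 1 else n - 1)"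
    by (rule walk_neighbours[OF det, where N = "Suc N" and s = s]) (simp add: c_def n_def del: power_Suc)
  define e where "e b = emeasure \<mu> (ball_t N (c b) \<inter> high g k)" for b
  have sum: "emeasure \<mu> (ball_t (Suc N) s \<inter> high g k) = (\<Sum>b\<in>UNIV. e b)"
    unfolding e_def c_def by (rule emeasure_ball_t_Suc[OF assms(1) O_invariant_high])
  have up: "e b = of_nat (tail_from_below CARD('a) (n + 1) N k)" if "k1 * b + k2 = 0 \<or> n = 0" for b
    using Suc.IH[of "c b"] that by (simp add: par k(3) e_def)
  have down: "e b = of_nat (tail_from_above CARD('a) (n - 1) N k)" if "\<not> (k1 * b + k2 = 0 \<or> n = 0)" for b
    using Suc.IH[of "c b"] that by (simp add: par k(3) e_def)
  show ?case
  proof (cases "k1 = 0 \<or> n = 0")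
    case True
    have "(\<Sum>b\<in>UNIV. e b) = of_nat (tail_from_above CARD('a) n (Suc N) k)"
    proof (cases "n = 0")
      case True
      then show ?thesis using up odd assms(3) by (simp add: tail_from_above_0_Suc)
    next
      case False
      then have "e b = of_nat (tail_from_above CARD('a) (n - 1) N k)" for b
        using True k(1) by (intro down) auto
      then show ?thesis
        using False tail_from_above_Suc_Suc[of "CARD('a)" "n - 1" N k] by simp
    qed
    then show ?thesis
      using True k(2) sum by (simp flip: n_def)
  next
    case False
    define b0 where "b0 = - k2 / k1"
    have b0: "k1 * b + k2 = 0 \<longleftrightarrow> b = b0" for b
    proof -
      have "k1 * b + k2 = k1 * (b - b0)"
        using False by (simp add: b0_def distrib_left)
      then show ?thesis using False by simp
    qed
    have "(\<Sum>b\<in>UNIV. e b) = e b0 + (\<Sum>b\<in>UNIV - {b0}. e b)"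
      by (simp add: sum.remove)
    also have "e b0 = of_nat (tail_from_below CARD('a) (n + 1) N k)"
      by (rule up) (simp add: b0)
    also have "(\<Sum>b\<in>UNIV - {b0}. e b) = (\<Sum>b\<in>UNIV - {b0}. of_nat (tail_from_above CARD('a) (n - 1) N k))"
      using False b0 by (intro sum.cong refl down) auto
    also have "\<dots> = of_nat ((CARD('a) - 1) * tail_from_above CARD('a) (n - 1) N k)"
      by (simp add: card_Diff_singleton)
    finally have "(\<Sum>b\<in>UNIV. e b) = of_nat (tail_from_below CARD('a) n (Suc N) k)"
      using tail_from_below_Suc[of k n N "CARD('a)"] assms(3) odd False by (simp add: Suc_leI)
    moreover have "n - 1 \<noteq> n + 1"
      by simp
    ultimately show ?thesis
      unfolding n_def[symmetric] using False k(2) sum by simp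
  qed
qed

section \<open>Averages as sums over tails\<close>

text \<open>A function of the height is a combination of the indicators of the events that the height is at least \<open>2k\<close>.\<close>

lemma telescope_even:
  fixes \<Phi> :: "nat \<Rightarrow> 'b::real_vector"
  assumes "m \<le> K"
  shows "\<Phi> (2 * m) = \<Phi> 0 + (\<Sum>k\<in>{1..K}. of_bool (k \<le> m) *\<^sub>R (\<Phi> (2 * k) - \<Phi> (2 * (k - 1))))"
proof -
  have "(\<Sum>k\<in>{1..K}. of_bool (k \<le> m) *\<^sub>R (\<Phi> (2 * k) - \<Phi> (2 * (k - 1)))) =
      (\<Sum>k\<in>{1..m}. \<Phi> (2 * k) - \<Phi> (2 * (k - 1)))"
    using assms by (intro sum.mono_neutral_cong_right) auto
  also have "\<dots> = \<Phi> (2 * m) - \<Phi> 0"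
    by (induction m) simp_all
  finally show ?thesis by simp
qed

text \<open>The condition \<open>T (K + 1) = 0\<close> bounds the height everywhere on the ball, not just almost everywhere, because the height is
  constant on cosets of \<open>\<O>\<close> and these have measure \<open>1\<close>.\<close>

lemma lambda_den_tails:
  fixes g :: "'a::{finite,field} mat2" and \<mu> :: "'a fls measure"
  assumes "normalized_haar \<mu>" "g \<in> SL2_F"
    and tail: "\<And>k. k \<ge> 1 \<Longrightarrow> emeasure \<mu> (ball_t N 0 \<inter> high g k) = of_nat (T k)"
    and "T (Suc K) = 0"
  shows "lambda_den \<mu> (coset g) N (\<Phi> \<circ> h_K) =
    \<Phi> 0 + (\<Sum>k\<in>{1..K}. (real (T k) / real CARD('a) ^ N) *\<^sub>R (\<Phi> (2 * k) - \<Phi> (2 * (k - 1))))"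
proof -
  let ?L = "\<lambda>k. ball_t N 0 \<inter> high g k" and ?\<delta> = "\<lambda>k. \<Phi> (2 * k) - \<Phi> (2 * (k - 1))"
  have sets: "sets \<mu> = sets borel" and space: "space \<mu> = UNIV"
    using assms(1) sets_eq_imp_space_eq[of \<mu> borel] by (auto simp: normalized_haar_def)
  have inv: "O_invariant (?L k)" "O_invariant (ball_t N 0 :: 'a fls set)" for k
    by (intro O_invariant_Int O_invariant_ball_t O_invariant_high)+
  have meas: "?L k \<in> sets \<mu>" "ball_t N 0 \<in> sets \<mu>" for k
    using inv by (simp_all add: sets O_invariant_borel)
  have empty: "?L (Suc K) = {}"
  proof (rule ccontr)
    assume "?L (Suc K) \<noteq> {}"
    then obtain x where "x \<in> ?L (Suc K)" by blast
    then have "ball_t 0 x \<subseteq> ?L (Suc K)"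
      using inv(1)[of "Suc K"] unfolding O_invariant_def ball_t_def tpow_O_0 by blast
    then have "emeasure \<mu> (ball_t 0 x) \<le> 0"
      using emeasure_mono[OF _ meas(1)[of "Suc K"], of "ball_t 0 x"] tail[of "Suc K"] assms(4) by simp
    then show False
      using emeasure_ball_t_0[OF assms(1), of x] by simp
  qed
  have ball: "tpow_O N = ball_t N 0"
    by (simp add: ball_t_def)
  have pointwise: "indicator (tpow_O N) s *\<^sub>R (\<Phi> \<circ> h_K) (right_translate (coset g) (unip s)) =
      indicator (ball_t N 0) s *\<^sub>R \<Phi> 0 + (\<Sum>k\<in>{1..K}. indicator (?L k) s *\<^sub>R ?\<delta> k)" for s
  proof (cases "s \<in> ball_t N 0")
    case True
    obtain m where m: "walk g 0 s = 2 * m"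
      using walk_even[OF assms(2), of 0 s] by (auto elim: evenE)
    have "m \<le> K"
      using empty True m by (auto simp: high_def)
    have "indicator (?L k) s = (of_bool (k \<le> m) :: real)" for k
      using True m by (simp add: high_def indicator_def)
    then show ?thesis
      using True m telescope_even[OF \<open>m \<le> K\<close>, of \<Phi>] by (simp add: ball h_K_walk)
  qed (simp add: ball)
  have fin: "emeasure \<mu> (ball_t N 0) < \<infinity>"
    unfolding emeasure_ball_t[OF assms(1)] infinity_ennreal_def by (rule of_nat_less_top)
  have measure_ball: "measure \<mu> (ball_t N 0) = real CARD('a) ^ N"
    unfolding measure_def emeasure_ball_t[OF assms(1)] enn2real_of_nat by simp
  have fin_L: "emeasure \<mu> (?L k) < \<infinity>" if "k \<in> {1..K}" for k
  proof -
    have "(of_nat (T k) :: ennreal) < top" by (rule of_nat_less_top)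
    then show ?thesis using tail[of k] that by simp
  qed
  have "(LINT s:tpow_O N|\<mu>. (\<Phi> \<circ> h_K) (right_translate (coset g) (unip s))) =
      (LINT s|\<mu>. indicator (ball_t N 0) s *\<^sub>R \<Phi> 0 + (\<Sum>k\<in>{1..K}. indicator (?L k) s *\<^sub>R ?\<delta> k))"
    unfolding set_lebesgue_integral_def pointwise ..
  also have "\<dots> = (LINT s|\<mu>. indicator (ball_t N 0) s *\<^sub>R \<Phi> 0) +
      (LINT s|\<mu>. (\<Sum>k\<in>{1..K}. indicator (?L k) s *\<^sub>R ?\<delta> k))"
    using fin fin_L meas
    by (intro Bochner_Integration.integral_add Bochner_Integration.integrable_sum integrable_scaleR_left impI)
      (auto simp: integrable_indicator_iff space)
  also have "(LINT s|\<mu>. (\<Sum>k\<in>{1..K}. indicator (?L k) s *\<^sub>R ?\<delta> k)) =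
      (\<Sum>k\<in>{1..K}. LINT s|\<mu>. indicator (?L k) s *\<^sub>R ?\<delta> k)"
    using fin_L meas by (intro Bochner_Integration.integral_sum integrable_scaleR_left impI) (auto simp: integrable_indicator_iff space)
  also have "(LINT s|\<mu>. indicator (ball_t N 0) s *\<^sub>R \<Phi> 0) = (real CARD('a) ^ N) *\<^sub>R \<Phi> 0"
    using fin meas measure_ball
    by (subst integral_scaleR_left) (auto simp: integrable_indicator_iff space simp del: of_nat_power)
  also have "(\<Sum>k\<in>{1..K}. LINT s|\<mu>. indicator (?L k) s *\<^sub>R ?\<delta> k) = (\<Sum>k\<in>{1..K}. real (T k) *\<^sub>R ?\<delta> k)"
  proof (rule sum.cong[OF refl])
    fix k assume k: "k \<in> {1..K}"
    have "measure \<mu> (?L k) = real (T k)"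
      using tail[of k] k by (simp add: measure_def)
    then show "(LINT s|\<mu>. indicator (?L k) s *\<^sub>R ?\<delta> k) = real (T k) *\<^sub>R ?\<delta> k"
      using fin_L[OF k] meas by (subst integral_scaleR_left) (auto simp: integrable_indicator_iff space)
  qed
  finally show ?thesis
    by (simp add: lambda_den_def add_divide_distrib scaleR_conv_of_real sum_divide_distrib del: of_nat_power flip: of_nat_power)
qed

section \<open>The mean of the limit distribution\<close>

text \<open>The mass that \<open>\<rho>\<^sup>e\<^sup>v\<close> gives to the heights \<open>2k, 2k + 2, \<dots>\<close>.\<close>

definition limit_tail :: "nat \<Rightarrow> nat \<Rightarrow> real" where
  "limit_tail q k = (if k = 0 then 1 else real q powr (1 - 2 * real k))"

lemma rho_ev_limit_tail:
  assumes "q \<ge> 2" shows "rho_ev q (2 * m) = limit_tail q m - limit_tail q (Suc m)"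
proof (cases "m = 0")
  case True
  then show ?thesis
    using assms by (simp add: rho_ev_def limit_tail_def powr_minus field_simps)
next
  case False
  have q: "real q > 0" using assms by simp
  have "real q ^ (2 * m + 1) = real q powr (2 * real m + 1)"
    using q powr_realpow[OF q, of "2 * m + 1"] by (simp add: add.commute)
  moreover have "real q powr (1 - 2 * real m) * real q powr (2 * real m + 1) = (real q)\<^sup>2"
    "real q powr (1 - 2 * real (Suc m)) * real q powr (2 * real m + 1) = 1"
    using q by (simp_all flip: powr_add)
  ultimately show ?thesis
    using False q by (simp add: rho_ev_def limit_tail_def field_simps)
qed

lemma limit_tail_nonneg: "0 \<le> limit_tail q k"
  by (simp add: limit_tail_def)

lemma rho_ev_bounds:
  assumes "q \<ge> 2"
  shows "0 \<le> rho_ev q (2 * m)" "rho_ev q (2 * m) \<le> real q * real q powr (- 2 * real m)"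
proof -
  show "0 \<le> rho_ev q (2 * m)"
    using assms by (auto simp: rho_ev_def intro!: divide_nonneg_nonneg)
  have "rho_ev q (2 * m) \<le> limit_tail q m"
    using rho_ev_limit_tail[OF assms, of m] limit_tail_nonneg[of q "Suc m"] by linarith
  also have "\<dots> \<le> real q powr (1 + (- 2 * real m))"
    using assms by (simp add: limit_tail_def)
  also have "\<dots> = real q * real q powr (- 2 * real m)"
    using assms by (subst powr_add) simp
  finally show "rho_ev q (2 * m) \<le> real q * real q powr (- 2 * real m)" .
qed

text \<open>This expresses the mean through the same increments of \<open>\<Phi>\<close> as the horospherical averages.\<close>

lemma summation_by_parts:
  fixes \<Phi> :: "nat \<Rightarrow> complex"
  assumes "q \<ge> 2"
  shows "(\<Sum>m\<le>K. \<Phi> (2 * m) * of_real (rho_ev q (2 * m))) =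
    \<Phi> 0 + (\<Sum>k\<in>{1..K}. limit_tail q k *\<^sub>R (\<Phi> (2 * k) - \<Phi> (2 * (k - 1))))
    - limit_tail q (Suc K) *\<^sub>R \<Phi> (2 * K)"
proof (induction K)
  case 0
  then show ?case
    by (simp add: rho_ev_limit_tail[OF assms, of 0, simplified] scaleR_conv_of_real)
      (simp add: limit_tail_def algebra_simps)
next
  case (Suc K)
  show ?case
    by (simp only: sum.atMost_Suc Suc.IH rho_ev_limit_tail[OF assms, of "Suc K"])
      (simp add: scaleR_conv_of_real algebra_simps)
qed

text \<open>The summand \<open>1\<close> pays for the boundary term of the summation by parts, the geometric series for the part of the mean
  beyond height \<open>2K\<close>.\<close>

definition tail_const :: "real \<Rightarrow> real \<Rightarrow> real" where
  "tail_const q \<alpha> = 1 + q / (1 - q powr (\<alpha> - 2))"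

text \<open>The growth bound on \<open>\<Phi>\<close> at \<open>2k\<close> and at \<open>2k - 2\<close> bounds the increment by this constant times \<open>C q\<^bsup>\<alpha>k\<^esup>\<close>.\<close>

definition increment_const :: "real \<Rightarrow> real \<Rightarrow> real" where
  "increment_const q \<alpha> = 1 + q powr (- \<alpha>)"

text \<open>The weights \<open>p k\<close> stand for the tail probabilities of the walk. Where they agree with the tails of \<open>\<rho>\<^sup>e\<^sup>v\<close> they contribute
  nothing, and the truncation at \<open>K\<close> costs a geometric tail of ratio \<open>q\<^bsup>\<alpha>-2\<^esup> < 1\<close>.\<close>

lemma mean_error:
  fixes \<Phi> :: "nat \<Rightarrow> complex" and q :: nat and \<alpha> C :: real
  defines "D \<equiv> increment_const (real q) \<alpha>" and "A \<equiv> tail_const (real q) \<alpha>"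
  assumes q: "q \<ge> 2" and \<alpha>: "\<alpha> < 2" and C: "C > 0"
    and growth: "\<And>m. cmod (\<Phi> (2 * m)) \<le> C * real q powr (\<alpha> * real m)"
  shows "cmod (\<Phi> 0 + (\<Sum>k\<in>{1..K}. p k *\<^sub>R (\<Phi> (2 * k) - \<Phi> (2 * (k - 1)))) - mean_rho_ev q \<Phi>)
    \<le> C * (D * (\<Sum>k\<in>{1..K}. \<bar>p k - limit_tail q k\<bar> * real q powr (\<alpha> * real k))
        + A * real q powr ((\<alpha> - 2) * real K))"
proof -
  define x where "x = real q powr (\<alpha> - 2)"
  have q0: "real q > 1" using q by simp
  have x: "0 < x" "x < 1"
    using q0 \<alpha> by (auto simp: x_def powr_less_one)
  have xpow: "x ^ m = real q powr ((\<alpha> - 2) * real m)" for m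
    using q0 by (simp add: x_def powr_powr flip: powr_realpow)
  let ?f = "\<lambda>m. \<Phi> (2 * m) * of_real (rho_ev q (2 * m))" and ?\<delta> = "\<lambda>k. \<Phi> (2 * k) - \<Phi> (2 * (k - 1))"
  have f: "norm (?f m) \<le> C * real q * x ^ m" for m
  proof -
    have "norm (?f m) \<le> (C * real q powr (\<alpha> * real m)) * (real q * real q powr (- 2 * real m))"
      unfolding norm_mult norm_of_real using rho_ev_bounds[OF q, of m] growth[of m] C
      by (intro mult_mono) auto
    also have "\<dots> = C * real q * (real q powr (\<alpha> * real m) * real q powr (- 2 * real m))"
      by simp
    also have "\<dots> = C * real q * x ^ m"
      by (simp add: xpow algebra_simps flip: powr_add)
    finally show ?thesis .
  qed
  have geo: "summable (\<lambda>m. C * real q * x ^ m)"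
    using x by (intro summable_mult summable_geometric) auto
  have sf: "summable ?f"
    using f by (intro summable_comparison_test[OF _ geo]) blast
  have "mean_rho_ev q \<Phi> = (\<Sum>m. ?f (m + Suc K)) + (\<Sum>m<Suc K. ?f m)"
    unfolding mean_rho_ev_def by (rule suminf_split_initial_segment[OF sf])
  then have mean: "mean_rho_ev q \<Phi> = (\<Sum>m. ?f (m + Suc K)) +
      (\<Phi> 0 + (\<Sum>k\<in>{1..K}. limit_tail q k *\<^sub>R ?\<delta> k) - limit_tail q (Suc K) *\<^sub>R \<Phi> (2 * K))"
    unfolding lessThan_Suc_atMost summation_by_parts[OF q] .
  have "norm (\<Sum>m. ?f (m + Suc K)) \<le> (\<Sum>m. C * real q * x ^ Suc K * x ^ m)"
  proof (rule norm_suminf_le)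
    show "norm (?f (m + Suc K)) \<le> C * real q * x ^ Suc K * x ^ m" for m
      using f[of "m + Suc K"] by (simp add: power_add mult_ac)
    show "summable (\<lambda>m. C * real q * x ^ Suc K * x ^ m)"
      using x by (intro summable_mult summable_geometric) auto
  qed
  also have "\<dots> = C * real q * x ^ Suc K * (1 / (1 - x))"
    using x by (subst suminf_mult) (auto simp: suminf_geometric)
  also have "\<dots> \<le> C * real q * x ^ K * (1 / (1 - x))"
    using x q0 C by (intro mult_right_mono mult_left_mono) (auto simp: mult_le_cancel_right1)
  finally have T1: "norm (\<Sum>m. ?f (m + Suc K)) \<le> C * (real q / (1 - x)) * x ^ K"
    by (simp add: mult_ac)
  have "norm (limit_tail q (Suc K) *\<^sub>R \<Phi> (2 * K)) \<le> real q powr (- 2 * real K) * (C * real q powr (\<alpha> * real K))"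
    unfolding norm_scaleR using growth[of K] q0 limit_tail_nonneg[of q "Suc K"]
    by (intro mult_mono) (auto simp: limit_tail_def)
  also have "\<dots> = C * x ^ K"
    by (simp add: xpow algebra_simps flip: powr_add)
  finally have T2: "norm (limit_tail q (Suc K) *\<^sub>R \<Phi> (2 * K)) \<le> C * x ^ K" .
  have \<delta>: "norm (?\<delta> k) \<le> C * D * real q powr (\<alpha> * real k)" if "k \<in> {1..K}" for k
  proof -
    have "norm (?\<delta> k) \<le> C * real q powr (\<alpha> * real k) + C * real q powr (\<alpha> * real (k - 1))"
      using norm_triangle_ineq4[of "\<Phi> (2 * k)" "\<Phi> (2 * (k - 1))"] growth[of k] growth[of "k - 1"] by linarith
    also have "\<alpha> * real (k - 1) = - \<alpha> + \<alpha> * real k"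
      using that by (simp add: of_nat_diff algebra_simps)
    also have "C * real q powr (\<alpha> * real k) + C * real q powr (- \<alpha> + \<alpha> * real k) = C * D * real q powr (\<alpha> * real k)"
      by (simp only: D_def increment_const_def powr_add) (simp add: algebra_simps)
    finally show ?thesis .
  qed
  have "norm (\<Sum>k\<in>{1..K}. (p k - limit_tail q k) *\<^sub>R ?\<delta> k) \<le>
      (\<Sum>k\<in>{1..K}. \<bar>p k - limit_tail q k\<bar> * (C * D * real q powr (\<alpha> * real k)))"
    using \<delta> by (intro sum_norm_le) (simp add: mult_left_mono)
  also have "\<dots> = C * D * (\<Sum>k\<in>{1..K}. \<bar>p k - limit_tail q k\<bar> * real q powr (\<alpha> * real k))"
    by (simp add: sum_distrib_left mult_ac)
  finally have T3: "norm (\<Sum>k\<in>{1..K}. (p k - limit_tail q k) *\<^sub>R ?\<delta> k) \<le>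
      C * D * (\<Sum>k\<in>{1..K}. \<bar>p k - limit_tail q k\<bar> * real q powr (\<alpha> * real k))" .
  have "\<Phi> 0 + (\<Sum>k\<in>{1..K}. p k *\<^sub>R ?\<delta> k) - mean_rho_ev q \<Phi> =
      (\<Sum>k\<in>{1..K}. (p k - limit_tail q k) *\<^sub>R ?\<delta> k) + limit_tail q (Suc K) *\<^sub>R \<Phi> (2 * K) - (\<Sum>m. ?f (m + Suc K))"
    unfolding mean scaleR_left_diff_distrib sum_subtractf by (simp add: algebra_simps)
  then have "cmod (\<Phi> 0 + (\<Sum>k\<in>{1..K}. p k *\<^sub>R ?\<delta> k) - mean_rho_ev q \<Phi>) \<le>
      C * D * (\<Sum>k\<in>{1..K}. \<bar>p k - limit_tail q k\<bar> * real q powr (\<alpha> * real k)) + C * x ^ K + C * (real q / (1 - x)) * x ^ K"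
    using T1 T2 T3 by (smt (verit) norm_triangle_ineq norm_triangle_ineq4)
  also have "\<dots> = C * (D * (\<Sum>k\<in>{1..K}. \<bar>p k - limit_tail q k\<bar> * real q powr (\<alpha> * real k)) + A * x ^ K)"
    by (simp add: A_def tail_const_def x_def algebra_simps)
  finally show ?thesis
    by (simp only: xpow)
qed

section \<open>Error terms on the two halves of an excursion\<close>

lemma CARD_ge_2: "CARD('a::{finite,field}) \<ge> 2"
  using card_mono[of "UNIV :: 'a set" "{0, 1}"] by simp

text \<open>After its descent to height \<open>0\<close> the walk has \<open>2K\<close> steps left. All tails up to \<open>k = K\<close> are those of the limit and
  no larger height is reached.\<close>

lemma err_from_above:
  fixes \<mu> :: "'a::{finite,field} fls measure"
  defines "q \<equiv> real CARD('a)"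
  assumes haar: "normalized_haar \<mu>" and g: "g \<in> SL2_F" and \<alpha>: "\<alpha> < 2" and C: "C > 0"
    and growth: "\<And>m. cmod (\<Phi> (2 * m)) \<le> C * q powr (\<alpha> * real m)"
    and N: "N = 2 * K + n" "walk g N 0 = n" "walk g (Suc N) 0 = n + 1"
  shows "err \<mu> \<Phi> (coset g) N \<le> C * (tail_const q \<alpha> * q powr ((\<alpha> - 2) * real K))"
proof -
  let ?T = "tail_from_above CARD('a) n N"
  have q: "q > 1" using CARD_ge_2[where 'a='a] by (simp add: q_def)
  have "emeasure \<mu> (ball_t N 0 \<inter> high g k) = of_nat (?T k)" if "k \<ge> 1" for k
    using emeasure_high[OF haar g that, of N 0] N by simp
  moreover have "?T (Suc K) = 0"
    using N(1) by (simp add: tail_from_above_def)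
  ultimately have lam: "lambda_den \<mu> (coset g) N (\<Phi> \<circ> h_K) =
      \<Phi> 0 + (\<Sum>k\<in>{1..K}. (real (?T k) / q ^ N) *\<^sub>R (\<Phi> (2 * k) - \<Phi> (2 * (k - 1))))"
    unfolding q_def by (rule lambda_den_tails[OF haar g])
  have "real (?T k) / q ^ N = limit_tail CARD('a) k" if "k \<in> {1..K}" for k
  proof -
    have "real (?T k) = q powr (real N + 1 - 2 * real k)"
      using that N(1) q by (simp add: tail_from_above_def q_def[symmetric] powr_realpow[symmetric] of_nat_diff add.commute)
    then show ?thesis
      using q that by (simp add: limit_tail_def q_def[symmetric] powr_realpow[symmetric] powr_diff[symmetric])
  qed
  then have "(\<Sum>k\<in>{1..K}. \<bar>real (?T k) / q ^ N - limit_tail CARD('a) k\<bar> * q powr (\<alpha> * real k)) = 0"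
    by (intro sum.neutral) simp
  then show ?thesis
    using mean_error[OF CARD_ge_2 \<alpha> C growth[unfolded q_def], where p = "\<lambda>k. real (?T k) / q ^ N" and K = K]
    by (simp add: err_def lam q_def)
qed

text \<open>The tails are exact for \<open>k \<le> H\<close>. For \<open>H < k \<le> K\<close> they equal \<open>q\<^bsup>-H-k\<^esup>\<close>, the probability of climbing \<open>H + k\<close> steps in a row
  from the start. This is at least the limit value \<open>q\<^bsup>1-2k\<^esup>\<close>, so it also bounds the difference.\<close>

lemma err_from_below:
  fixes \<mu> :: "'a::{finite,field} fls measure"
  defines "q \<equiv> real CARD('a)"
  assumes haar: "normalized_haar \<mu>" and g: "g \<in> SL2_F" and \<alpha>: "\<alpha> < 2" and C: "C > 0"
    and growth: "\<And>m. cmod (\<Phi> (2 * m)) \<le> C * q powr (\<alpha> * real m)"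
    and N: "N = H + K" "H + n = K" "walk g N 0 = n" "walk g (Suc N) 0 + 1 = n"
  shows "err \<mu> \<Phi> (coset g) N \<le>
    C * (increment_const q \<alpha> * (\<Sum>k\<in>{H+1..K}. q powr ((\<alpha> - 1) * real k)) * q powr (- real H)
      + tail_const q \<alpha> * q powr ((\<alpha> - 2) * real K))"
proof -
  let ?T = "tail_from_below CARD('a) n N" and ?S = "limit_tail CARD('a)"
  have q: "q > 1" using CARD_ge_2[where 'a='a] by (simp add: q_def)
  have n: "n \<ge> 1" using N(4) by simp
  have "emeasure \<mu> (ball_t N 0 \<inter> high g k) = of_nat (?T k)" if "k \<ge> 1" for k
    using emeasure_high[OF haar g that, of N 0] N(3,4) by simp
  moreover have "?T (Suc K) = 0"
    using N(1,2) by (simp add: tail_from_below_def)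
  ultimately have lam: "lambda_den \<mu> (coset g) N (\<Phi> \<circ> h_K) =
      \<Phi> 0 + (\<Sum>k\<in>{1..K}. (real (?T k) / q ^ N) *\<^sub>R (\<Phi> (2 * k) - \<Phi> (2 * (k - 1))))"
    unfolding q_def by (rule lambda_den_tails[OF haar g])
  have low: "real (?T k) / q ^ N = ?S k" if "k \<in> {1..H}" for k
  proof -
    have "?T k = CARD('a) ^ (N + 1 - 2 * k)"
      using that N(1,2) by (simp add: tail_from_below_def)
    then have "real (?T k) = q powr (real N + 1 - 2 * real k)"
      using that N(1,2) q by (simp add: q_def[symmetric] powr_realpow[symmetric] of_nat_diff add.commute)
    then show ?thesis
      using q that by (simp add: limit_tail_def q_def[symmetric] powr_realpow[symmetric] powr_diff[symmetric])
  qed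
  have high: "\<bar>real (?T k) / q ^ N - ?S k\<bar> \<le> q powr (- real H - real k)" if "k \<in> {H+1..K}" for k
  proof -
    have "(n + N) div 2 = K"
      using N(1,2) by simp
    then have "?T k = CARD('a) ^ (K - k)"
      using that N(1,2) by (simp add: tail_from_below_def)
    then have "real (?T k) = q powr (real K - real k)"
      using that q by (simp add: q_def[symmetric] powr_realpow[symmetric] of_nat_diff)
    then have "real (?T k) / q ^ N = q powr (- real H - real k)"
      using q N(1) by (simp add: powr_realpow[symmetric] powr_diff[symmetric] algebra_simps)
    moreover have "0 \<le> ?S k"
      by (rule limit_tail_nonneg)
    moreover have "?S k \<le> q powr (- real H - real k)"
      using that q by (auto simp: limit_tail_def q_def[symmetric])
    ultimately show ?thesis by simp
  qed
  have "(\<Sum>k\<in>{1..K}. \<bar>real (?T k) / q ^ N - ?S k\<bar> * q powr (\<alpha> * real k)) =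
      (\<Sum>k\<in>{H+1..K}. \<bar>real (?T k) / q ^ N - ?S k\<bar> * q powr (\<alpha> * real k))"
    by (intro sum.mono_neutral_right) (auto simp: low)
  also have "\<dots> \<le> (\<Sum>k\<in>{H+1..K}. q powr (- real H - real k) * q powr (\<alpha> * real k))"
    by (intro sum_mono mult_right_mono high) simp_all
  also have "\<dots> = (\<Sum>k\<in>{H+1..K}. q powr ((\<alpha> - 1) * real k)) * q powr (- real H)"
    unfolding sum_distrib_right by (intro sum.cong refl) (simp add: algebra_simps flip: powr_add)
  finally have "increment_const q \<alpha> * (\<Sum>k\<in>{1..K}. \<bar>real (?T k) / q ^ N - ?S k\<bar> * q powr (\<alpha> * real k)) \<le>
      increment_const q \<alpha> * ((\<Sum>k\<in>{H+1..K}. q powr ((\<alpha> - 1) * real k)) * q powr (- real H))"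
    by (intro mult_left_mono) (simp_all add: increment_const_def)
  then have "C * (increment_const q \<alpha> * (\<Sum>k\<in>{1..K}. \<bar>real (?T k) / q ^ N - ?S k\<bar> * q powr (\<alpha> * real k))
      + tail_const q \<alpha> * q powr ((\<alpha> - 2) * real K)) \<le>
    C * (increment_const q \<alpha> * (\<Sum>k\<in>{H+1..K}. q powr ((\<alpha> - 1) * real k)) * q powr (- real H)
      + tail_const q \<alpha> * q powr ((\<alpha> - 2) * real K))"
    using C by (intro mult_left_mono add_right_mono) (simp_all add: mult.assoc)
  moreover have "err \<mu> \<Phi> (coset g) N \<le>
      C * (increment_const q \<alpha> * (\<Sum>k\<in>{1..K}. \<bar>real (?T k) / q ^ N - ?S k\<bar> * q powr (\<alpha> * real k))
      + tail_const q \<alpha> * q powr ((\<alpha> - 2) * real K))"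
    using mean_error[OF CARD_ge_2 \<alpha> C growth[unfolded q_def], where p = "\<lambda>k. real (?T k) / q ^ N" and K = K]
    by (simp add: err_def lam q_def)
  ultimately show ?thesis by linarith
qed

text \<open>The sum of \<open>q\<^bsup>(\<alpha>-1)k\<^esup>\<close> over \<open>H < k \<le> K\<close> is controlled by the limit of the geometric series, by the number of its terms or by
  its last term.\<close>

definition growth_const :: "real \<Rightarrow> real \<Rightarrow> real" where
  "growth_const q \<alpha> = (if \<alpha> < 1 then 1 / (1 - q powr (\<alpha> - 1)) else if \<alpha> = 1 then 1
     else q powr (\<alpha> - 1) / (q powr (\<alpha> - 1) - 1))"

lemma growth_sum:
  assumes "q > 1" "H \<le> K"
  shows "\<alpha> < 1 \<Longrightarrow> (\<Sum>k\<in>{H+1..K}. q powr ((\<alpha> - 1) * real k)) \<le> growth_const q \<alpha>"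
    and "\<alpha> = 1 \<Longrightarrow> (\<Sum>k\<in>{H+1..K}. q powr ((\<alpha> - 1) * real k)) \<le> growth_const q \<alpha> * real (K - H)"
    and "1 < \<alpha> \<Longrightarrow> (\<Sum>k\<in>{H+1..K}. q powr ((\<alpha> - 1) * real k)) \<le> growth_const q \<alpha> * q powr ((\<alpha> - 1) * real K)"
proof -
  define z where "z = q powr (\<alpha> - 1)"
  have zpow: "q powr ((\<alpha> - 1) * real k) = z ^ k" for k
    using assms by (simp add: z_def powr_powr flip: powr_realpow)
  have z0: "z > 0" using assms by (simp add: z_def)
  have le: "(\<Sum>k\<in>{H+1..K}. z ^ k) \<le> (\<Sum>k<Suc K. z ^ k)"
    using z0 by (intro sum_mono2) auto
  {
    assume "\<alpha> < 1"
    then have z: "z < 1" using assms by (simp add: z_def powr_less_one)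
    have "(\<Sum>k<Suc K. z ^ k) \<le> (\<Sum>k. z ^ k)"
      using z z0 by (intro sum_le_suminf summable_geometric) auto
    then show "(\<Sum>k\<in>{H+1..K}. q powr ((\<alpha> - 1) * real k)) \<le> growth_const q \<alpha>"
      using le z z0 \<open>\<alpha> < 1\<close> by (simp add: zpow growth_const_def suminf_geometric flip: z_def)
  }
  {
    assume "\<alpha> = 1"
    then show "(\<Sum>k\<in>{H+1..K}. q powr ((\<alpha> - 1) * real k)) \<le> growth_const q \<alpha> * real (K - H)"
      using assms by (simp add: growth_const_def)
  }
  {
    assume "1 < \<alpha>"
    then have z: "z > 1" using assms by (simp add: z_def)
    have "(\<Sum>k<Suc K. z ^ k) = (z ^ Suc K - 1) / (z - 1)"
      using z by (intro geometric_sum) simp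
    also have "\<dots> \<le> z ^ Suc K / (z - 1)"
      using z by (intro divide_right_mono) simp_all
    finally show "(\<Sum>k\<in>{H+1..K}. q powr ((\<alpha> - 1) * real k)) \<le> growth_const q \<alpha> * q powr ((\<alpha> - 1) * real K)"
      using le \<open>1 < \<alpha>\<close> by (simp add: zpow growth_const_def flip: z_def)
  }
qed

lemma growth_const_pos: "q > 1 \<Longrightarrow> growth_const q \<alpha> > 0"
  by (auto simp: growth_const_def powr_less_one)

lemma tail_const_pos: "q > 1 \<Longrightarrow> \<alpha> < 2 \<Longrightarrow> tail_const q \<alpha> > 0"
  using powr_less_one[of q "\<alpha> - 2"] by (simp add: tail_const_def add_pos_pos)

section \<open>The excursion between consecutive return times\<close>

text \<open>A sequence with steps of size \<open>1\<close> that starts and ends at \<open>0\<close> can reach \<open>d\<close> within \<open>2d\<close> steps only in the middle,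
  and then no step can be wasted.\<close>

lemma excursion_shape:
  fixes k :: "nat \<Rightarrow> nat"
  assumes step: "\<And>N. k (Suc N) = k N + 1 \<or> k (Suc N) + 1 = k N"
    and ends: "k B = 0" "k (B + 2 * d) = 0" and max: "d = Max (k ` {B..B + 2 * d})" and "j \<le> d"
  shows "k (B + j) = j" "k (B + d + j) = d - j"
proof -
  have lip: "k (N + i) \<le> k N + i \<and> k N \<le> k (N + i) + i" for N i
  proof (induction i)
    case (Suc i)
    then show ?case using step[of "N + i"] by auto
  qed simp
  have "d \<in> k ` {B..B + 2 * d}"
    using Max_in[of "k ` {B..B + 2 * d}"] max by simp
  then obtain N where N: "N \<in> {B..B + 2 * d}" "k N = d" by auto
  then obtain i where i: "N = B + i" "i \<le> 2 * d"
    by (metis atLeastAtMost_iff le_Suc_ex nat_add_left_cancel_le)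
  have "d \<le> i" "d \<le> 2 * d - i"
    using lip[of B i] lip[of "B + i" "2 * d - i"] ends N(2) i by simp_all
  then have "i = d" using i(2) by linarith
  then have top: "k (B + d) = d" using N i by simp
  have eq: "B + j + (d - j) = B + d" "B + d + j + (d - j) = B + 2 * d"
    using \<open>j \<le> d\<close> by simp_all
  show "k (B + j) = j"
    using lip[of B j] lip[of "B + j" "d - j"] top ends(1) \<open>j \<le> d\<close> unfolding eq by linarith
  show "k (B + d + j) = d - j"
    using lip[of "B + d" j] lip[of "B + d + j" "d - j"] top ends(2) \<open>j \<le> d\<close> unfolding eq by linarith
qed

lemma walk_step:
  assumes "g \<in> SL2_F" shows "walk g (Suc N) s = walk g N s + 1 \<or> walk g (Suc N) s + 1 = walk g N s"
proof -
  have "det g \<noteq> 0" using assms by (simp add: SL2_F_def)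
  then obtain k1 :: 'a where "walk g (Suc N) s = (if k1 = 0 \<or> walk g N s = 0 then walk g N s + 1 else walk g N s - 1)"
    using walk_neighbours by blast
  then show ?thesis by (auto split: if_splits)
qed

lemma admissible_walk:
  assumes "admissible_indexing g B d" "g \<in> SL2_F" "r \<ge> 1" "j \<le> d r"
  shows "walk g (B r + j) 0 = j" "walk g (B r + d r + j) 0 = d r - j" "even (B r)"
proof -
  have ret: "walk g (B r) 0 = 0" if "r \<ge> 1" for r
  proof -
    have "B r \<in> return_times (coset g)"
      using assms(1) that unfolding admissible_indexing_def by blast
    then show ?thesis by (simp add: return_times_def k_height_walk)
  qed
  have "d r = Max (k_height (coset g) ` {B r..B (r + 1)})" "B (r + 1) = B r + 2 * d r"
    using assms(1,3) unfolding admissible_indexing_def by blast+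
  then have "walk g (B r + 2 * d r) 0 = 0" "d r = Max ((\<lambda>N. walk g N 0) ` {B r..B r + 2 * d r})"
    using ret[of "r + 1"] by (simp_all add: k_height_walk)
  note shape = excursion_shape[where k = "\<lambda>N. walk g N 0", OF walk_step[OF assms(2)] ret[OF assms(3)] this assms(4)]
  show "walk g (B r + j) 0 = j" "walk g (B r + d r + j) 0 = d r - j"
    by (rule shape)+
  show "even (B r)"
    using walk_even[OF assms(2), of "B r" 0] ret[OF assms(3)] by simp
qed

theorem corollary5p11:
  fixes \<alpha> :: real
  assumes "\<alpha> < 2"
  defines "q \<equiv> real CARD('a::{finite,field})"
    and "\<beta> \<equiv> (2 - \<alpha>) / 2"
  shows "\<exists>M>0. \<forall>(\<mu> :: 'a fls measure) (g :: 'a mat2) (B :: nat \<Rightarrow> nat) (d :: nat \<Rightarrow> nat)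
            (\<Phi> :: nat \<Rightarrow> complex) (C :: real).
      normalized_haar \<mu> \<longrightarrow> g \<in> SL2_F \<longrightarrow> act_P1 g pt_infinity \<notin> P1_rat \<longrightarrow>
      admissible_indexing g B d \<longrightarrow>
      C > 0 \<longrightarrow> (\<forall>m. cmod (\<Phi> (2 * m)) \<le> C * q powr (\<alpha> * real m)) \<longrightarrow>
      (\<forall>r\<ge>1. \<forall>j<d r.
         err \<mu> \<Phi> (coset g) (B r + j) \<le> M * (C * q powr (- \<beta> * real (B r))) \<and>
         (\<alpha> < 1 \<longrightarrow>
            err \<mu> \<Phi> (coset g) (B r + d r + j) \<le> M * (C * q powr (- real (B r) / 2 - real j))) \<and>
         (\<alpha> = 1 \<longrightarrow>
            err \<mu> \<Phi> (coset g) (B r + d r + j)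
              \<le> M * (C * real (B r + d r + j + 1) * q powr (- real (B r) / 2 - real j))) \<and>
         (1 < \<alpha> \<longrightarrow>
            err \<mu> \<Phi> (coset g) (B r + d r + j)
              \<le> M * (C * q powr (- \<beta> * real (B r) + (\<alpha> - 1) * real (d r) - real j))))"
proof -
  have q: "q > 1"
    using CARD_ge_2[where 'a='a] by (simp add: q_def)
  define A D G where "A = tail_const q \<alpha>" and "D = increment_const q \<alpha>" and "G = growth_const q \<alpha>"
  have pos: "A > 0" "D > 0" "G > 0"
    using q assms(1) by (simp_all add: A_def D_def G_def tail_const_pos growth_const_pos increment_const_def add_pos_pos)
  define M where "M = D * G + A"
  have "M > 0" "A \<le> M"
    using pos by (simp_all add: M_def add_pos_pos)
  show ?thesis
  proof (rule exI[of _ M], intro conjI[OF \<open>M > 0\<close>] allI impI)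
    fix \<mu> :: "'a fls measure" and g :: "'a mat2" and B d :: "nat \<Rightarrow> nat" and \<Phi> :: "nat \<Rightarrow> complex"
      and C :: real and r j :: nat
    assume haar: "normalized_haar \<mu>" and g: "g \<in> SL2_F" and adm: "admissible_indexing g B d"
      and C: "C > 0" and growth: "\<forall>m. cmod (\<Phi> (2 * m)) \<le> C * q powr (\<alpha> * real m)"
      and r: "r \<ge> 1" and j: "j < d r"
    have walk: "walk g (B r + i) 0 = i" "walk g (B r + d r + i) 0 = d r - i" "even (B r)" if "i \<le> d r" for i
      using admissible_walk[OF adm g r that] .
    obtain b where b: "B r = 2 * b"
      using walk(3)[of 0] by (auto elim: evenE)
    have \<beta>b: "\<beta> * real (B r) = (2 - \<alpha>) * real b"
      by (simp add: \<beta>_def b)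
    note growth' = growth[rule_format, unfolded q_def]
    have "err \<mu> \<Phi> (coset g) (B r + j) \<le> C * (A * q powr ((\<alpha> - 2) * real b))"
      unfolding A_def q_def
      by (rule err_from_above[OF haar g assms(1) C growth', where n = j])
        (use walk(1)[of j] walk(1)[of "Suc j"] j b in simp_all)
    also have "(\<alpha> - 2) * real b = - \<beta> * real (B r)"
      using \<beta>b by (simp add: algebra_simps)
    also have "C * (A * q powr (- \<beta> * real (B r))) \<le> M * (C * q powr (- \<beta> * real (B r)))"
      using mult_right_mono[OF \<open>A \<le> M\<close>, of "C * q powr (- \<beta> * real (B r))"] C by (simp add: mult_ac)
    finally have asc: "err \<mu> \<Phi> (coset g) (B r + j) \<le> M * (C * q powr (- \<beta> * real (B r)))" .
    define H K where "H = b + j" and "K = b + d r"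
    have HK: "H \<le> K" using j by (simp add: H_def K_def)
    define S where "S = (\<Sum>k\<in>{H+1..K}. q powr ((\<alpha> - 1) * real k))"
    have E: "err \<mu> \<Phi> (coset g) (B r + d r + j) \<le>
        C * (D * S * q powr (- real H) + A * q powr ((\<alpha> - 2) * real K))"
      unfolding A_def D_def S_def q_def
      by (rule err_from_below[OF haar g assms(1) C growth', where n = "d r - j"])
        (use walk(2)[of j] walk(2)[of "Suc j"] j b in \<open>simp_all add: H_def K_def\<close>)
    \<comment> \<open>The factor \<open>w\<close> is \<open>1\<close>, \<open>N + 1\<close> or \<open>q\<^bsup>(\<alpha>-1)K\<^esup>\<close>. The truncation error is absorbed because
        \<open>q\<^bsup>(\<alpha>-2)K\<^esup> = q\<^bsup>(\<alpha>-1)K\<^esup> q\<^bsup>-K\<^esup>\<close> and \<open>H \<le> K\<close>.\<close>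
    have bound: "err \<mu> \<Phi> (coset g) (B r + d r + j) \<le> M * (C * w * q powr (- real H))"
      if S: "S \<le> G * w" and w: "q powr ((\<alpha> - 1) * real K) \<le> w" for w
    proof -
      have "q powr ((\<alpha> - 2) * real K) = q powr ((\<alpha> - 1) * real K) * q powr (- real K)"
        by (simp add: algebra_simps flip: powr_add)
      also have "\<dots> \<le> w * q powr (- real H)"
        using w HK q order_trans[OF powr_ge_zero w] by (intro mult_mono) simp_all
      finally have "A * q powr ((\<alpha> - 2) * real K) \<le> A * (w * q powr (- real H))"
        using pos by simp
      moreover have "D * S * q powr (- real H) \<le> D * (G * w) * q powr (- real H)"
        using S pos by (intro mult_right_mono mult_left_mono) simp_all
      ultimately have "D * S * q powr (- real H) + A * q powr ((\<alpha> - 2) * real K) \<le> M * w * q powr (- real H)"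
        by (simp add: M_def algebra_simps)
      then have "C * (D * S * q powr (- real H) + A * q powr ((\<alpha> - 2) * real K)) \<le> C * (M * w * q powr (- real H))"
        using C by simp
      then show ?thesis using E by (simp add: mult_ac)
    qed
    have Hb: "- real H = - real (B r) / 2 - real j"
      by (simp add: H_def b)
    show "err \<mu> \<Phi> (coset g) (B r + j) \<le> M * (C * q powr (- \<beta> * real (B r))) \<and>
         (\<alpha> < 1 \<longrightarrow>
            err \<mu> \<Phi> (coset g) (B r + d r + j) \<le> M * (C * q powr (- real (B r) / 2 - real j))) \<and>
         (\<alpha> = 1 \<longrightarrow>
            err \<mu> \<Phi> (coset g) (B r + d r + j)
              \<le> M * (C * real (B r + d r + j + 1) * q powr (- real (B r) / 2 - real j))) \<and>
         (1 < \<alpha> \<longrightarrow>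
            err \<mu> \<Phi> (coset g) (B r + d r + j)
              \<le> M * (C * q powr (- \<beta> * real (B r) + (\<alpha> - 1) * real (d r) - real j)))"
    proof (intro conjI impI asc)
      assume \<alpha>: "\<alpha> < 1"
      then have "q powr ((\<alpha> - 1) * real K) \<le> q powr 0"
        using q by (intro powr_mono) (simp_all add: mult_nonpos_nonneg)
      with growth_sum(1)[OF q HK \<alpha>] show
        "err \<mu> \<Phi> (coset g) (B r + d r + j) \<le> M * (C * q powr (- real (B r) / 2 - real j))"
        using bound[of 1] q by (simp add: S_def G_def Hb)
    next
      assume \<alpha>: "\<alpha> = 1"
      have "S \<le> G * real (K - H)"
        using growth_sum(2)[OF q HK \<alpha>] by (simp add: S_def G_def)
      also have "\<dots> \<le> G * real (B r + d r + j + 1)"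
        using pos by (intro mult_left_mono) (simp_all add: H_def K_def)
      finally show "err \<mu> \<Phi> (coset g) (B r + d r + j)
          \<le> M * (C * real (B r + d r + j + 1) * q powr (- real (B r) / 2 - real j))"
        unfolding Hb[symmetric] using \<alpha> q by (intro bound) simp_all
    next
      assume \<alpha>: "1 < \<alpha>"
      have "err \<mu> \<Phi> (coset g) (B r + d r + j) \<le> M * (C * q powr ((\<alpha> - 1) * real K) * q powr (- real H))"
        using growth_sum(3)[OF q HK \<alpha>] by (intro bound) (simp_all add: S_def G_def)
      also have "C * q powr ((\<alpha> - 1) * real K) * q powr (- real H) =
          C * q powr ((\<alpha> - 1) * real K - real H)"
        by (simp add: powr_diff powr_minus divide_inverse)
      also have "(\<alpha> - 1) * real K - real H = - \<beta> * real (B r) + (\<alpha> - 1) * real (d r) - real j"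
        using \<beta>b by (simp add: H_def K_def algebra_simps)
      finally show "err \<mu> \<Phi> (coset g) (B r + d r + j)
          \<le> M * (C * q powr (- \<beta> * real (B r) + (\<alpha> - 1) * real (d r) - real j))" .
    qed
  qed
qed

end
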